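(* Let $\eta=\{p_i,\rho_i\}_{i=1}^m$ be an ensemble of states on a finite-dimensional system $A$ with probabilities $p_i$, and let $n\ge1$. Then the $n$-broadcasting fidelity $g_n(\eta)$ equals the optimal value of the semidefinite program \[ \begin{aligned} \max\ &\sum_{i=1}^m\tfrac12 p_i\,\mathrm{tr}(X_i+X_i^\dagger)\\ \text{s.t. }&\begin{pmatrix}\rho_i & X_i\\ X_i^\dagger & \mathrm{tr}_{\backslash A_1}(J_{AA_1\cdots A_n}\rho_i^T)\end{pmatrix}\ge0\quad\forall i\in\{1,\dots,m\},\\ & J_{AA_1\cdots A_n}\ge0,\quad \mathrm{tr}_{A_1\cdots A_n}J_{AA_1\cdots A_n}=\mathbb{1}_A,\\ & J_{AA_1\cdots A_n}=\frac1{n!}\sum_{\pi\in S_n}W_\pi J_{AA_1\cdots A_n}W_\pi^\dagger, \end{aligned} \] with variables linear operators $X_1,\dots,X_m$ and Hermitian $J_{AA_1\cdots A_n}$, where $W_\pi$ acts on $A_1\cdots A_n$ and $\mathrm{tr}_{\backslash A_1}(J\rho_i^T)$ denotes $J(\rho_i^T\otimes\mathbb{1}_{A_1\cdots A_n})$ with all systems except $A_1$ traced out ($A_1$ identified with $A$).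
   Context: Fidelity: $F(\rho,\sigma)=\mathrm{tr}\sqrt{\sqrt{\rho}\sigma\sqrt{\rho}}$. Systems $A_1,\dots,A_n$ are copies of $A$ with a fixed orthonormal basis $\{|j\rangle\}$; transpose $T$ is taken in that basis. The $n$-broadcasting fidelity of the ensemble is \[g_n(\eta)=\sup\Big\{\sum_{i=1}^m\sum_{j=1}^n\frac1n p_iF\big(\rho_i,\mathrm{tr}_{\backslash A_j}\Lambda_{A\to A_1\cdots A_n}(\rho_i)\big):\ \Lambda\text{ a quantum channel}\Big\},\] where $\mathrm{tr}_{\backslash A_j}$ traces out all outputs except $A_j$. For $\pi\in S_n$, $W_\pi|j_1,\dots,j_n\rangle=|j_{\pi^{-1}(1)},\dots,j_{\pi^{-1}(n)}\rangle$ on $A_1\cdots A_n$. *)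

theory Defs
  imports "Jordan_Normal_Form.Schur_Decomposition" "HOL-Combinatorics.Permutations"
begin

definition mtrace :: "complex mat \<Rightarrow> complex" where
  "mtrace A = (\<Sum>i<dim_row A. A $$ (i, i))"

definition hermitian :: "complex mat \<Rightarrow> bool" where
  "hermitian A \<longleftrightarrow> square_mat A \<and> mat_adjoint A = A"

definition psd :: "complex mat \<Rightarrow> bool" where
  "psd A \<longleftrightarrow> hermitian A \<and>
     (\<forall>v. dim_vec v = dim_row A \<longrightarrow>
        Im (conjugate v \<bullet> (A *\<^sub>v v)) = 0 \<and> 0 \<le> Re (conjugate v \<bullet> (A *\<^sub>v v)))"

definition density :: "nat \<Rightarrow> complex mat \<Rightarrow> bool" where
  "density d \<rho> \<longleftrightarrow> \<rho> \<in> carrier_mat d d \<and> psd \<rho> \<and> mtrace \<rho> = 1"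

definition msqrt :: "complex mat \<Rightarrow> complex mat" where
  "msqrt A = (THE B. psd B \<and> dim_row B = dim_row A \<and> B * B = A)"

definition fidelity :: "complex mat \<Rightarrow> complex mat \<Rightarrow> real" where
  "fidelity \<rho> \<sigma> = Re (mtrace (msqrt (msqrt \<rho> * \<sigma> * msqrt \<rho>)))"

text \<open>Kronecker (tensor) product; index of the first factor is the most significant.\<close>
definition kron :: "complex mat \<Rightarrow> complex mat \<Rightarrow> complex mat" where
  "kron A B = mat (dim_row A * dim_row B) (dim_col A * dim_col B)
     (\<lambda>(i, j). A $$ (i div dim_row B, j div dim_col B) * B $$ (i mod dim_row B, j mod dim_col B))"

text \<open>Basis index of \<open>|j_0,...,j_{N-1}\<rangle>\<close> is \<open>\<Sum>_k j_k d^(N-1-k)\<close>;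
  \<open>digit d N k idx\<close> is \<open>j_k\<close>.\<close>
definition digit :: "nat \<Rightarrow> nat \<Rightarrow> nat \<Rightarrow> nat \<Rightarrow> nat" where
  "digit d N k idx = (idx div d ^ (N - 1 - k)) mod d"

text \<open>Partial trace over all systems except system k (0-based) of N systems.\<close>
definition ptr_keep :: "nat \<Rightarrow> nat \<Rightarrow> nat \<Rightarrow> complex mat \<Rightarrow> complex mat" where
  "ptr_keep d N k M = mat d d (\<lambda>(a, b).
     \<Sum>r<d ^ N. \<Sum>c<d ^ N.
       if digit d N k r = a \<and> digit d N k c = b \<and> (\<forall>l<N. l \<noteq> k \<longrightarrow> digit d N l r = digit d N l c)
       then M $$ (r, c) else 0)"

definition perm_index :: "nat \<Rightarrow> nat \<Rightarrow> (nat \<Rightarrow> nat) \<Rightarrow> nat \<Rightarrow> nat" where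
  "perm_index d N \<pi> idx = (\<Sum>l<N. digit d N (inv_into UNIV \<pi> l) idx * d ^ (N - 1 - l))"

text \<open>\<open>W_\<pi> |j_0,...,j_{N-1}\<rangle> = |j_{\<pi>^-1(0)},...,j_{\<pi>^-1(N-1)}\<rangle>\<close>.\<close>
definition Wmat :: "nat \<Rightarrow> nat \<Rightarrow> (nat \<Rightarrow> nat) \<Rightarrow> complex mat" where
  "Wmat d N \<pi> = mat (d ^ N) (d ^ N) (\<lambda>(r, c). if r = perm_index d N \<pi> c then 1 else 0)"

definition block :: "nat \<Rightarrow> complex mat \<Rightarrow> nat \<Rightarrow> nat \<Rightarrow> complex mat" where
  "block D M i j = mat D D (\<lambda>(a, b). M $$ (i * D + a, j * D + b))"

text \<open>\<open>id_k \<otimes> \<Lambda>\<close> for a map \<open>\<Lambda>\<close> from d x d to D x D matrices (ancilla first).\<close>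
definition ext_map :: "nat \<Rightarrow> nat \<Rightarrow> nat \<Rightarrow> (complex mat \<Rightarrow> complex mat) \<Rightarrow> complex mat \<Rightarrow> complex mat" where
  "ext_map k d D \<Lambda> M = mat (k * D) (k * D)
     (\<lambda>(r, c). \<Lambda> (block d M (r div D) (c div D)) $$ (r mod D, c mod D))"

definition quantum_channel :: "nat \<Rightarrow> nat \<Rightarrow> (complex mat \<Rightarrow> complex mat) \<Rightarrow> bool" where
  "quantum_channel d D \<Lambda> \<longleftrightarrow>
     (\<forall>A \<in> carrier_mat d d. \<Lambda> A \<in> carrier_mat D D) \<and>
     (\<forall>A \<in> carrier_mat d d. \<forall>B \<in> carrier_mat d d. \<Lambda> (A + B) = \<Lambda> A + \<Lambda> B) \<and>
     (\<forall>A \<in> carrier_mat d d. \<forall>c. \<Lambda> (c \<cdot>\<^sub>m A) = c \<cdot>\<^sub>m \<Lambda> A) \<and>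
     (\<forall>A \<in> carrier_mat d d. mtrace (\<Lambda> A) = mtrace A) \<and>
     (\<forall>k. \<forall>M \<in> carrier_mat (k * d) (k * d). psd M \<longrightarrow> psd (ext_map k d D \<Lambda> M))"

text \<open>Ensemble of m states \<open>\<rho> 0, ..., \<rho> (m-1)\<close>; output systems \<open>A_1..A_n\<close> are indexed 0..n-1.\<close>
definition broadcast_fidelity ::
  "nat \<Rightarrow> nat \<Rightarrow> nat \<Rightarrow> (nat \<Rightarrow> real) \<Rightarrow> (nat \<Rightarrow> complex mat) \<Rightarrow> real" where
  "broadcast_fidelity d n m p \<rho> =
     (SUP \<Lambda> \<in> {\<Lambda>. quantum_channel d (d ^ n) \<Lambda>}.
        \<Sum>i<m. \<Sum>j<n. (1 / real n) * p i * fidelity (\<rho> i) (ptr_keep d n j (\<Lambda> (\<rho> i))))"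

text \<open>Twirl over permutations of \<open>A_1..A_n\<close> for J on \<open>A A_1 \<dots> A_n\<close>
  (systems 0..n, A is system 0): \<open>(1/n!) \<Sum>_\<pi> W_\<pi> J W_\<pi>\<^sup>\<dagger>\<close>.\<close>
definition sym_twirl :: "nat \<Rightarrow> nat \<Rightarrow> complex mat \<Rightarrow> complex mat" where
  "sym_twirl d n J = mat (d ^ (n + 1)) (d ^ (n + 1)) (\<lambda>(r, c).
     (1 / of_nat (fact n)) *
       (\<Sum>\<pi> \<in> {\<pi>. \<pi> permutes {1..n}}.
          (Wmat d (n + 1) \<pi> * J * mat_adjoint (Wmat d (n + 1) \<pi>)) $$ (r, c)))"

definition sdp_feasible ::
  "nat \<Rightarrow> nat \<Rightarrow> nat \<Rightarrow> (nat \<Rightarrow> complex mat) \<Rightarrow> (nat \<Rightarrow> complex mat) \<Rightarrow> complex mat \<Rightarrow> bool" where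
  "sdp_feasible d n m \<rho> X J \<longleftrightarrow>
     (\<forall>i<m. X i \<in> carrier_mat d d \<and>
        psd (four_block_mat (\<rho> i) (X i) (mat_adjoint (X i))
              (ptr_keep d (n + 1) 1 (J * kron (transpose_mat (\<rho> i)) (1\<^sub>m (d ^ n)))))) \<and>
     J \<in> carrier_mat (d ^ (n + 1)) (d ^ (n + 1)) \<and> hermitian J \<and>
     psd J \<and>
     ptr_keep d (n + 1) 0 J = 1\<^sub>m d \<and>
     J = sym_twirl d n J"

definition sdp_value :: "nat \<Rightarrow> nat \<Rightarrow> nat \<Rightarrow> (nat \<Rightarrow> real) \<Rightarrow> (nat \<Rightarrow> complex mat) \<Rightarrow> real" where
  "sdp_value d n m p \<rho> =
     Sup {\<Sum>i<m. (1 / 2) * p i * Re (mtrace (X i + mat_adjoint (X i))) | X J. sdp_feasible d n m \<rho> X J}"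

end

theory Submission
  imports Defs "Jordan_Normal_Form.Spectral_Radius"
begin

text \<open>
  A channel corresponds to its Choi matrix \<open>J\<close>, and the fidelity of two states is the largest
  \<open>Re tr X\<close> over all off-diagonal blocks \<open>X\<close> completing them to a positive block matrix.
  Replacing \<open>J\<close> by its average over permutations of the outputs replaces each output marginal by
  the mean of all of them; averaging the optimal \<open>X\<close> for the individual marginals gives a feasible
  \<open>X\<close> for that mean with the same value. Conversely all output marginals of a symmetric \<open>J\<close>
  coincide, so a feasible pair is dominated by the channel of \<open>J\<close>.

  Attainment of the fidelity comes from the polar decomposition of \<open>sqrt \<sigma> sqrt \<rho>\<close>. The upper
  bound pairs the positive block matrix with \<open>(a, -b)\<close> where \<open>b a\<^sup>\<dagger> = 1\<close>; \<open>a\<close> and \<open>b\<close> are built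
  from \<open>sqrt \<rho> + \<delta>\<close> and \<open>sqrt (sqrt \<rho> \<sigma> sqrt \<rho>) + \<epsilon>\<close>, and then \<open>\<delta>\<close> and \<open>\<epsilon>\<close> tend to zero.
\<close>

section \<open>Adjoint, trace and positivity\<close>

text \<open>Let \<open>S\<close> be the root of \<rho> and \<open>P\<close> the root of S \<sigma>
  S. If both were invertible, the best pairing would have a \<open>a a\<^sup>\<dagger>\<close> equal
  to S^-1 P S^-1 and a \<open>b b\<^sup>\<dagger>\<close> equal to S P^-1 S: each of the two
  resulting traces is then tr P, which is the fidelity. Singular matrices are the obstacle. The two
  shifts are sent to zero one after the other, because the coefficients of \<delta> depend on
  \<epsilon> through the inverse of the shifted P.

  Concavity of the fidelity enters in disguise: positive block matrices form a convex cone and tr X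
  is linear, so averaging whole block matrices averages the fidelities that they attain.

  The twirl acts on J, but the constraint concerns J multiplied by the transposed input. The two
  operations commute because permutations of the outputs fix the input system, and this is what lets
  statements on twirled matrices speak about output states.\<close>

lemma adj_dim[simp]:
  "dim_row (mat_adjoint A) = dim_col A" "dim_col (mat_adjoint A) = dim_row A"
  by (auto simp: mat_adjoint_def)

lemma adj_carrier[simp]: "mat_adjoint A \<in> carrier_mat n m \<longleftrightarrow> A \<in> carrier_mat m n"
  by (metis adj_dim carrier_matD carrier_matI)

lemma adj_index[simp]:
  "i < dim_col A \<Longrightarrow> j < dim_row A \<Longrightarrow> mat_adjoint A $$ (i, j) = cnj (A $$ (j, i))"
  by (auto simp: mat_adjoint_def mat_of_rows_def)

lemma adj_adj[simp]: "mat_adjoint (mat_adjoint (A :: complex mat)) = A"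
  by (rule eq_matI) auto

lemma mult_index:
  assumes "A \<in> carrier_mat n m" "B \<in> carrier_mat m l" "i < n" "j < l"
  shows "(A * B) $$ (i, j) = (\<Sum>k<m. A $$ (i, k) * B $$ (k, j))"
  using assms by (auto simp: scalar_prod_def atLeast0LessThan)

lemma adj_mult:
  assumes "A \<in> carrier_mat n m" "B \<in> carrier_mat m l"
  shows "mat_adjoint (A * B :: complex mat) = mat_adjoint B * mat_adjoint A"
  by (rule eq_matI, insert assms, auto simp: scalar_prod_def mult.commute intro!: sum.cong)

lemma adj_one[simp]: "mat_adjoint (1\<^sub>m n :: complex mat) = 1\<^sub>m n"
  by (rule eq_matI) auto

lemma adj_zero[simp]: "mat_adjoint (0\<^sub>m n m :: complex mat) = 0\<^sub>m m n"
  by (rule eq_matI) auto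

lemma mtrace_carrier: "A \<in> carrier_mat n m \<Longrightarrow> mtrace A = (\<Sum>i<n. A $$ (i, i))"
  by (auto simp: mtrace_def)

lemma mtrace_comm:
  assumes "A \<in> carrier_mat n m" "B \<in> carrier_mat m n"
  shows "mtrace (A * B) = mtrace (B * A)"
proof -
  have "mtrace (A * B) = (\<Sum>i<n. \<Sum>k<m. A $$ (i, k) * B $$ (k, i))"
    using assms by (subst mtrace_carrier[of _ n n]) (auto simp: mult_index[of _ n m _ n] simp del: index_mult_mat(1))
  also have "\<dots> = (\<Sum>k<m. \<Sum>i<n. B $$ (k, i) * A $$ (i, k))"
    by (subst sum.swap) (simp add: mult.commute)
  also have "\<dots> = mtrace (B * A)"
    using assms by (subst mtrace_carrier[of _ m m]) (auto simp: mult_index[of _ m n _ m] simp del: index_mult_mat(1))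
  finally show ?thesis .
qed

lemma mtrace_add:
  assumes "A \<in> carrier_mat n n" "B \<in> carrier_mat n n"
  shows "mtrace (A + B) = mtrace A + mtrace B"
  using assms by (auto simp: mtrace_def sum.distrib)

lemma mtrace_lin:
  assumes "A \<in> carrier_mat n n" "B \<in> carrier_mat n n" "C \<in> carrier_mat n n"
  shows "mtrace (A + b \<cdot>\<^sub>m B + c \<cdot>\<^sub>m C) = mtrace A + b * mtrace B + c * mtrace C"
  using assms by (simp add: mtrace_def sum.distrib sum_distrib_left)

lemma mtrace_adj: "A \<in> carrier_mat n n \<Longrightarrow> mtrace (mat_adjoint A) = cnj (mtrace A)"
  by (auto simp: mtrace_def)

section \<open>Positivity through quadratic forms\<close>

lemma quadratic_form:
  assumes "A \<in> carrier_mat n n" "dim_vec v = n"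
  shows "conjugate v \<bullet> (A *\<^sub>v v) = (\<Sum>i<n. \<Sum>j<n. cnj (v $ i) * A $$ (i, j) * v $ j)"
  using assms by (auto simp: scalar_prod_def atLeast0LessThan sum_distrib_left mult.assoc intro!: sum.cong)

text \<open>On complex numbers \<open>0 \<le> z\<close> means real and nonnegative, so a single
  inequality carries both conditions on the quadratic form. Quantifying over functions instead of
  vectors removes the dimension side condition, and the entrywise form suits the later index
  sums.\<close>

lemma psd_iff:
  assumes A: "A \<in> carrier_mat n n"
  shows "psd A \<longleftrightarrow> (\<forall>i<n. \<forall>j<n. cnj (A $$ (j, i)) = A $$ (i, j)) \<and>
    (\<forall>f. 0 \<le> (\<Sum>i<n. \<Sum>j<n. cnj (f i) * A $$ (i, j) * f j))" (is "_ \<longleftrightarrow> ?H \<and> ?Q")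
proof -
  have "hermitian A \<longleftrightarrow> mat_adjoint A = A"
    using A by (auto simp: hermitian_def)
  also have "\<dots> \<longleftrightarrow> ?H"
    using A by (auto simp: mat_eq_iff)
  finally have h: "hermitian A \<longleftrightarrow> ?H" .
  have "(\<forall>v. dim_vec v = dim_row A \<longrightarrow>
        Im (conjugate v \<bullet> (A *\<^sub>v v)) = 0 \<and> 0 \<le> Re (conjugate v \<bullet> (A *\<^sub>v v))) \<longleftrightarrow>
      (\<forall>v. dim_vec v = n \<longrightarrow> 0 \<le> (\<Sum>i<n. \<Sum>j<n. cnj (v $ i) * A $$ (i, j) * v $ j))"
    using A by (auto simp: quadratic_form[OF A] less_eq_complex_def)
  also have "\<dots> \<longleftrightarrow> ?Q"
  proof (intro iffI allI impI)
    fix f assume "\<forall>v. dim_vec v = n \<longrightarrow> 0 \<le> (\<Sum>i<n. \<Sum>j<n. cnj (v $ i) * A $$ (i, j) * v $ j)"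
    then have "0 \<le> (\<Sum>i<n. \<Sum>j<n. cnj (vec n f $ i) * A $$ (i, j) * vec n f $ j)"
      by (rule allE[where x = "vec n f"]) simp
    then show "0 \<le> (\<Sum>i<n. \<Sum>j<n. cnj (f i) * A $$ (i, j) * f j)"
      by (simp cong: sum.cong_simp)
  next
    fix v :: "complex vec" assume ?Q
    then show "0 \<le> (\<Sum>i<n. \<Sum>j<n. cnj (v $ i) * A $$ (i, j) * v $ j)"
      by (rule allE[where x = "($) v"])
  qed
  finally show ?thesis unfolding psd_def h by (rule arg_cong)
qed

lemma psd_hermitian: "psd A \<Longrightarrow> mat_adjoint A = A"
  by (simp add: psd_def hermitian_def)

text \<open>Partial traces, twirls and completely positive maps are all of the form \<open>\<Sum>\<kappa> W\<kappa>\<^sup>\<dagger> M W\<kappa>\<close>.\<close>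
lemma psd_kraus:
  assumes M: "M \<in> carrier_mat N N" "psd M" and A: "A \<in> carrier_mat n n"
    and eq: "\<And>i j. i < n \<Longrightarrow> j < n \<Longrightarrow>
      A $$ (i, j) = (\<Sum>\<kappa>\<in>K. \<Sum>r<N. \<Sum>c<N. cnj (w \<kappa> i r) * M $$ (r, c) * w \<kappa> j c)"
  shows "psd A"
  unfolding psd_iff[OF A]
proof (intro conjI allI impI)
  fix i j assume ij: "i < n" "j < n"
  have Mh: "cnj (M $$ (c, r)) = M $$ (r, c)" if "r < N" "c < N" for r c
    using M(2) unfolding psd_iff[OF M(1)] using that by blast
  have "cnj (A $$ (j, i)) = (\<Sum>\<kappa>\<in>K. \<Sum>r<N. \<Sum>c<N. w \<kappa> j r * cnj (M $$ (r, c)) * cnj (w \<kappa> i c))"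
    using ij by (simp add: eq)
  also have "\<dots> = (\<Sum>\<kappa>\<in>K. \<Sum>c<N. \<Sum>r<N. w \<kappa> j r * M $$ (c, r) * cnj (w \<kappa> i c))"
    by (subst sum.swap) (auto intro!: sum.cong simp: Mh)
  also have "\<dots> = A $$ (i, j)"
    using ij by (auto simp: eq mult_ac intro!: sum.cong)
  finally show "cnj (A $$ (j, i)) = A $$ (i, j)" .
next
  fix f :: "nat \<Rightarrow> complex"
  have Mq: "\<And>f. 0 \<le> (\<Sum>i<N. \<Sum>j<N. cnj (f i) * M $$ (i, j) * f j)"
    using M(2) unfolding psd_iff[OF M(1)] by auto
  \<comment> \<open>The form of \<open>A\<close> at \<open>f\<close> is the sum over \<kappa> of the
    forms of \<open>M\<close> at \<open>g \<kappa>\<close>; what remains is to push the sums over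
    \<open>i\<close> and \<open>j\<close> inwards.\<close>
  define g where "g \<kappa> r = (\<Sum>i<n. w \<kappa> i r * f i)" for \<kappa> r
  have "(\<Sum>i<n. \<Sum>j<n. cnj (f i) * A $$ (i, j) * f j)
      = (\<Sum>i<n. \<Sum>j<n. \<Sum>\<kappa>\<in>K. \<Sum>r<N. \<Sum>c<N. (cnj (w \<kappa> i r * f i)) * M $$ (r, c) * (w \<kappa> j c * f j))"
    by (auto simp: eq sum_distrib_left sum_distrib_right mult_ac intro!: sum.cong)
  also have "\<dots> = (\<Sum>i<n. \<Sum>\<kappa>\<in>K. \<Sum>j<n. \<Sum>r<N. \<Sum>c<N. (cnj (w \<kappa> i r * f i)) * M $$ (r, c) * (w \<kappa> j c * f j))"
    by (rule sum.cong[OF refl], rule sum.swap)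
  also have "\<dots> = (\<Sum>\<kappa>\<in>K. \<Sum>i<n. \<Sum>j<n. \<Sum>r<N. \<Sum>c<N. (cnj (w \<kappa> i r * f i)) * M $$ (r, c) * (w \<kappa> j c * f j))"
    by (rule sum.swap)
  also have "\<dots> = (\<Sum>\<kappa>\<in>K. \<Sum>r<N. \<Sum>c<N. \<Sum>i<n. \<Sum>j<n. (cnj (w \<kappa> i r * f i)) * M $$ (r, c) * (w \<kappa> j c * f j))"
  proof (rule sum.cong[OF refl])
    fix \<kappa>
    let ?t = "\<lambda>i j r c. (cnj (w \<kappa> i r * f i)) * M $$ (r, c) * (w \<kappa> j c * f j)"
    have "(\<Sum>i<n. \<Sum>j<n. \<Sum>r<N. \<Sum>c<N. ?t i j r c) = (\<Sum>i<n. \<Sum>r<N. \<Sum>j<n. \<Sum>c<N. ?t i j r c)"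
      by (rule sum.cong[OF refl], rule sum.swap)
    also have "\<dots> = (\<Sum>r<N. \<Sum>i<n. \<Sum>j<n. \<Sum>c<N. ?t i j r c)"
      by (rule sum.swap)
    also have "\<dots> = (\<Sum>r<N. \<Sum>i<n. \<Sum>c<N. \<Sum>j<n. ?t i j r c)"
      by (rule sum.cong[OF refl], rule sum.cong[OF refl], rule sum.swap)
    also have "\<dots> = (\<Sum>r<N. \<Sum>c<N. \<Sum>i<n. \<Sum>j<n. ?t i j r c)"
      by (rule sum.cong[OF refl], rule sum.swap)
    finally show "(\<Sum>i<n. \<Sum>j<n. \<Sum>r<N. \<Sum>c<N. ?t i j r c) = (\<Sum>r<N. \<Sum>c<N. \<Sum>i<n. \<Sum>j<n. ?t i j r c)" .
  qed
  also have "\<dots> = (\<Sum>\<kappa>\<in>K. \<Sum>r<N. \<Sum>c<N. cnj (g \<kappa> r) * M $$ (r, c) * g \<kappa> c)"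
  proof -
    have "(\<Sum>i<n. \<Sum>j<n. (cnj (w \<kappa> i r * f i)) * M $$ (r, c) * (w \<kappa> j c * f j)) = cnj (g \<kappa> r) * M $$ (r, c) * g \<kappa> c" for \<kappa> r c
      by (simp only: g_def cnj_sum sum_distrib_right[of _ _ "M $$ (r, c)"] sum_product)
    then show ?thesis by simp
  qed
  also have "0 \<le> \<dots>"
    by (intro sum_nonneg Mq)
  finally show "0 \<le> (\<Sum>i<n. \<Sum>j<n. cnj (f i) * A $$ (i, j) * f j)" .
qed

lemma psd_one: "psd (1\<^sub>m n)"
proof (subst psd_iff[of _ n], simp, intro conjI allI impI)
  fix f :: "nat \<Rightarrow> complex"
  have "(\<Sum>i<n. \<Sum>j<n. cnj (f i) * (1\<^sub>m n) $$ (i, j) * f j) = (\<Sum>i<n. \<Sum>j<n. if i = j then cnj (f i) * f i else 0)"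
    by (intro sum.cong) auto
  also have "\<dots> = (\<Sum>i<n. cnj (f i) * f i)"
    by simp
  also have "0 \<le> \<dots>"
    by (intro sum_nonneg) (simp add: less_eq_complex_def)
  finally show "0 \<le> (\<Sum>i<n. \<Sum>j<n. cnj (f i) * (1\<^sub>m n) $$ (i, j) * f j)" .
qed auto

lemma psd_conj:
  assumes "M \<in> carrier_mat n n" "psd M" "C \<in> carrier_mat n m"
  shows "psd (mat_adjoint C * M * C)"
proof (rule psd_kraus[where K = "{()}" and w = "\<lambda>_ i r. C $$ (r, i)", OF assms(1,2)])
  fix i j assume ij: "i < m" "j < m"
  have "(mat_adjoint C * M * C) $$ (i, j) = (\<Sum>c<n. (\<Sum>r<n. cnj (C $$ (r, i)) * M $$ (r, c)) * C $$ (c, j))"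
    using assms ij by (subst mult_index[of _ m n _ m]) (auto simp: mult_index[of _ m n _ n] simp del: index_mult_mat(1))
  also have "\<dots> = (\<Sum>c<n. \<Sum>r<n. cnj (C $$ (r, i)) * M $$ (r, c) * C $$ (c, j))"
    by (simp add: sum_distrib_right)
  also have "\<dots> = (\<Sum>r<n. \<Sum>c<n. cnj (C $$ (r, i)) * M $$ (r, c) * C $$ (c, j))"
    by (rule sum.swap)
  finally show "(mat_adjoint C * M * C) $$ (i, j) =
    (\<Sum>\<kappa>\<in>{()}. \<Sum>r<n. \<Sum>c<n. cnj (C $$ (r, i)) * M $$ (r, c) * C $$ (c, j))" by simp
qed (use assms in auto)

lemma psd_gram:
  assumes "C \<in> carrier_mat n m"
  shows "psd (C * mat_adjoint C)"
  using psd_conj[of "1\<^sub>m m" m "mat_adjoint C" n] assms by (simp add: psd_one)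

lemma mtrace_psd:
  assumes "A \<in> carrier_mat n n" "psd A"
  shows "0 \<le> mtrace A"
proof -
  have "0 \<le> A $$ (i, i)" if i: "i < n" for i
  proof -
    let ?e = "\<lambda>k. if k = i then 1 else 0 :: complex"
    have "0 \<le> (\<Sum>k<n. \<Sum>j<n. cnj (?e k) * A $$ (k, j) * ?e j)"
      using assms(2) unfolding psd_iff[OF assms(1)] by (elim conjE) (erule allE[where x = ?e])
    also have "\<dots> = (\<Sum>k<n. if k = i then A $$ (k, i) else 0)"
    proof (rule sum.cong[OF refl])
      fix k
      have "(\<Sum>j<n. cnj (?e k) * A $$ (k, j) * ?e j) = (\<Sum>j<n. if j = i then cnj (?e k) * A $$ (k, j) else 0)"
        by (intro sum.cong) auto
      then show "(\<Sum>j<n. cnj (?e k) * A $$ (k, j) * ?e j) = (if k = i then A $$ (k, i) else 0)"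
        using i by simp
    qed
    finally show ?thesis using i by simp
  qed
  then show ?thesis using assms(1) by (auto simp: mtrace_carrier intro!: sum_nonneg)
qed

section \<open>Spectral theorem\<close>

definition unitary :: "nat \<Rightarrow> complex mat \<Rightarrow> bool" where
  "unitary n V \<longleftrightarrow> V \<in> carrier_mat n n \<and> mat_adjoint V * V = 1\<^sub>m n \<and> V * mat_adjoint V = 1\<^sub>m n"

lemma unitaryI: "V \<in> carrier_mat n n \<Longrightarrow> mat_adjoint V * V = 1\<^sub>m n \<Longrightarrow> unitary n V"
  by (simp add: unitary_def mat_mult_left_right_inverse[of "mat_adjoint V" n V])

lemma unitary_cancel:
  assumes "unitary n V" "Y \<in> carrier_mat n m"
  shows "mat_adjoint V * (V * Y) = Y" "V * (mat_adjoint V * Y) = Y"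
  using assms by (simp_all add: unitary_def flip: assoc_mult_mat[of _ n n _ n _ m])

lemma adj_mult_index:
  assumes "W \<in> carrier_mat n n" "i < n" "j < n"
  shows "(mat_adjoint W * W) $$ (i, j) = (\<Sum>k<n. cnj (W $$ (k, i)) * W $$ (k, j))"
  using assms by (subst mult_index[of _ n n _ n]) auto

text \<open>Completing \<open>v\<close> to a basis and orthogonalising keeps \<open>v\<close> as
  first vector; normalising changes it only by the scalar \<open>c\<close>, which is left open
  because an eigenvector matters only up to scaling.\<close>

lemma unitary_first_column:
  assumes v: "v \<in> carrier_vec n" "v \<noteq> 0\<^sub>v n" and n: "0 < n"
  shows "\<exists>U c. unitary n U \<and> (\<forall>i<n. U $$ (i, 0) = c * v $ i)"
proof -
  interpret cof_vec_space n "TYPE(complex)" .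
  define b where "b = basis_completion v"
  from basis_completion[OF v, folded b_def]
  have dist_b: "distinct b" and indep: "\<not> lin_dep (set b)" and b: "set b \<subseteq> carrier_vec n"
    and hdb: "hd b = v" and len_b: "length b = n" by auto
  from hdb len_b n obtain vs where bv: "b = v # vs" by (cases b) auto
  define ws where "ws = gram_schmidt n b"
  from gram_schmidt_result[OF b dist_b indep ws_def]
  have ws: "set ws \<subseteq> carrier_vec n" "corthogonal ws" "length ws = n" by (auto simp: len_b)
  have hdws: "ws ! 0 = v"
    using gram_schmidt_hd[OF v(1), of vs] bv ws n unfolding ws_def by (cases ws) (auto simp: hd_conv_nth ws_def)
  \<comment> \<open>\<open>corthogonal\<close> gives pairwise orthogonal vectors of nonzero norm,
    not unit vectors, hence the division.\<close>
  define U where "U = mat n n (\<lambda>(i, j). ws ! j $ i / complex_of_real (sqrt (\<Sum>k<n. (cmod (ws ! j $ k))\<^sup>2)))"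
  have sp: "(\<Sum>k<n. ws ! j $ k * cnj (ws ! i $ k)) = ws ! j \<bullet>c ws ! i" if "i < n" "j < n" for i j
    using ws that by (auto simp: scalar_prod_def atLeast0LessThan intro!: sum.cong) (metis carrier_vecD nth_mem subsetD)
  have pos: "(\<Sum>k<n. (cmod (ws ! j $ k))\<^sup>2) > 0" if j: "j < n" for j
  proof -
    have "(\<Sum>k<n. ws ! j $ k * cnj (ws ! j $ k)) \<noteq> 0"
      using corthogonalD[OF ws(2), of j j] ws j by (simp add: sp)
    then have "of_real (\<Sum>k<n. (cmod (ws ! j $ k))\<^sup>2) \<noteq> (0 :: complex)"
      by (simp add: complex_norm_square[symmetric] flip: of_real_power)
    then have "(\<Sum>k<n. (cmod (ws ! j $ k))\<^sup>2) \<noteq> 0" by (metis of_real_0)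
    then show ?thesis by (simp add: order_less_le sum_nonneg)
  qed
  have "mat_adjoint U * U = 1\<^sub>m n"
  proof (rule eq_matI)
    fix i j assume ij: "i < dim_row (1\<^sub>m n :: complex mat)" "j < dim_col (1\<^sub>m n :: complex mat)"
    let ?N = "\<lambda>j. complex_of_real (sqrt (\<Sum>k<n. (cmod (ws ! j $ k))\<^sup>2))"
    have "(mat_adjoint U * U) $$ (i, j) = (\<Sum>k<n. ws ! j $ k * cnj (ws ! i $ k)) / (?N i * ?N j)"
      using ij by (subst adj_mult_index[of _ n]) (auto simp: U_def sum_divide_distrib mult_ac intro!: sum.cong)
    also have "\<dots> = (if i = j then 1 else 0)"
    proof (cases "i = j")
      case True
      have "(\<Sum>k<n. ws ! j $ k * cnj (ws ! j $ k)) = of_real (\<Sum>k<n. (cmod (ws ! j $ k))\<^sup>2)"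
        by (simp add: complex_norm_square[symmetric] flip: of_real_power)
      also have "\<dots> = ?N j * ?N j"
        using pos[of j] ij by (simp only: of_real_mult[symmetric]) (simp add: sum_nonneg)
      finally show ?thesis using True pos[of j] ij by auto
    next
      case False
      then show ?thesis using sp[of i j] corthogonalD[OF ws(2), of j i] ws(3) ij by auto
    qed
    finally show "(mat_adjoint U * U) $$ (i, j) = 1\<^sub>m n $$ (i, j)" using ij by simp
  qed (auto simp: U_def)
  then have "unitary n U" by (intro unitaryI) (auto simp: U_def)
  moreover have "\<forall>i<n. U $$ (i, 0) = (1 / complex_of_real (sqrt (\<Sum>k<n. (cmod (ws ! 0 $ k))\<^sup>2))) * v $ i"
    using n hdws by (auto simp: U_def)
  ultimately show ?thesis by blast
qed

lemma unitary_mult: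
  assumes "unitary n U" "unitary n V"
  shows "unitary n (U * V)"
proof (rule unitaryI)
  have c: "U \<in> carrier_mat n n" "V \<in> carrier_mat n n" using assms by (auto simp: unitary_def)
  show "U * V \<in> carrier_mat n n" using c by simp
  have "mat_adjoint (U * V) * (U * V) = mat_adjoint V * V"
    using c by (simp add: adj_mult[OF c] assoc_mult_mat[of _ n n _ n _ n] unitary_cancel[OF assms(1), of _ n])
  then show "mat_adjoint (U * V) * (U * V) = 1\<^sub>m n" using assms by (simp add: unitary_def)
qed

lemma four_block_adj:
  fixes A :: "complex mat"
  assumes "A \<in> carrier_mat n1 m1" "B \<in> carrier_mat n1 m2" "C \<in> carrier_mat n2 m1" "D \<in> carrier_mat n2 m2"
  shows "mat_adjoint (four_block_mat A B C D) =
    four_block_mat (mat_adjoint A) (mat_adjoint C) (mat_adjoint B) (mat_adjoint D)"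
  by (rule eq_matI, insert assms, auto)

text \<open>With an eigenvector as first column of \<open>U\<close>, the conjugated matrix has first
  column \<open>e\<close> times the first unit vector; being Hermitian, it has a first row of the
  same shape. It thus splits into a 1 by 1 block and a smaller Hermitian block.\<close>

lemma hermitian_deflate:
  assumes A: "A \<in> carrier_mat n n" "mat_adjoint A = A" and n: "0 < n"
  obtains U e where "unitary n U" "mat_adjoint (mat_adjoint U * (A * U)) = mat_adjoint U * (A * U)"
    "\<And>i. i < n \<Longrightarrow> (mat_adjoint U * (A * U)) $$ (i, 0) = (if i = 0 then e else 0)"
    "\<And>j. j < n \<Longrightarrow> (mat_adjoint U * (A * U)) $$ (0, j) = (if j = 0 then e else 0)"
proof -
  from spectrum_non_empty[OF A(1) n] obtain e where "eigenvalue A e"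
    by (auto simp: spectrum_def)
  then obtain v where v: "v \<in> carrier_vec n" "v \<noteq> 0\<^sub>v n" "A *\<^sub>v v = e \<cdot>\<^sub>v v"
    using A by (auto simp: eigenvalue_def eigenvector_def)
  from unitary_first_column[OF v(1,2) n] obtain U c
    where U: "unitary n U" and Uv: "\<And>i. i < n \<Longrightarrow> U $$ (i, 0) = c * v $ i" by auto
  have Uc: "U \<in> carrier_mat n n" "mat_adjoint U * U = 1\<^sub>m n"
    using U by (auto simp: unitary_def)
  define A' where "A' = mat_adjoint U * (A * U)"
  have A': "A' \<in> carrier_mat n n" using A Uc by (auto simp: A'_def)
  have A'h: "mat_adjoint A' = A'"
    using A Uc(1)
    by (simp add: A'_def adj_mult[of _ n n _ n] assoc_mult_mat[of _ n n _ n _ n])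
  have AU0: "(A * U) $$ (i, 0) = e * U $$ (i, 0)" if i: "i < n" for i
  proof -
    have "(A * U) $$ (i, 0) = (\<Sum>k<n. A $$ (i, k) * U $$ (k, 0))"
      using A Uc i n by (subst mult_index[of _ n n _ n]) auto
    also have "\<dots> = c * (\<Sum>k<n. A $$ (i, k) * v $ k)"
      by (simp add: Uv sum_distrib_left mult_ac)
    also have "(\<Sum>k<n. A $$ (i, k) * v $ k) = (A *\<^sub>v v) $ i"
      using A v(1) i by (auto simp: scalar_prod_def atLeast0LessThan)
    finally show ?thesis using v i by (simp add: Uv del: index_mult_mat(1))
  qed
  have col0: "A' $$ (i, 0) = (if i = 0 then e else 0)" if i: "i < n" for i
  proof -
    have "A' $$ (i, 0) = (\<Sum>k<n. mat_adjoint U $$ (i, k) * (A * U) $$ (k, 0))"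
      unfolding A'_def using A Uc(1) i n by (intro mult_index[of _ n n _ n]) auto
    also have "\<dots> = e * (\<Sum>k<n. mat_adjoint U $$ (i, k) * U $$ (k, 0))"
      unfolding sum_distrib_left by (intro sum.cong) (simp_all add: AU0 del: index_mult_mat(1))
    also have "\<dots> = e * (mat_adjoint U * U) $$ (i, 0)"
      using Uc(1) i n by (subst mult_index[of _ n n _ n]) auto
    finally show ?thesis using Uc(2) i n by simp
  qed
  moreover have "A' $$ (0, j) = (if j = 0 then e else 0)" if j: "j < n" for j
  proof -
    have *: "cnj (A' $$ (j, i)) = A' $$ (i, j)" if "i < n" "j < n" for i j
      using adj_index[of i A' j] A' A'h that by simp
    show ?thesis using *[of 0 j] *[of 0 0] col0[of j] col0[of 0] j n by (auto split: if_splits)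
  qed
  ultimately show thesis using that U A'h unfolding A'_def by blast
qed

text \<open>Induction on the dimension by deflation. The eigenvalues are merely complex numbers
  here; \<open>psd_diagonalize\<close> obtains their realness and sign together from
  positivity.\<close>

lemma hermitian_diagonalizable:
  assumes "A \<in> carrier_mat n n" "mat_adjoint A = A"
  shows "\<exists>V f. unitary n V \<and> A = V * mat_diag n f * mat_adjoint V"
  using assms
proof (induction n arbitrary: A)
  case 0
  have "unitary 0 (1\<^sub>m 0)" by (rule unitaryI) auto
  moreover have "A = 1\<^sub>m 0 * mat_diag 0 (\<lambda>_. 0) * mat_adjoint (1\<^sub>m 0)"
    using 0 by (intro eq_matI) auto
  ultimately show ?case by blast
next
  case (Suc n)
  define N where "N = Suc n"
  have A: "A \<in> carrier_mat N N" "mat_adjoint A = A" using Suc.prems by (simp_all add: N_def)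
  obtain U e where U: "unitary N U" and A'h: "mat_adjoint (mat_adjoint U * (A * U)) = mat_adjoint U * (A * U)"
    and col0: "\<And>i. i < N \<Longrightarrow> (mat_adjoint U * (A * U)) $$ (i, 0) = (if i = 0 then e else 0)"
    and row0: "\<And>j. j < N \<Longrightarrow> (mat_adjoint U * (A * U)) $$ (0, j) = (if j = 0 then e else 0)"
    using hermitian_deflate[OF A] by (auto simp: N_def)
  have Uc: "U \<in> carrier_mat N N" using U by (auto simp: unitary_def)
  define A' where "A' = mat_adjoint U * (A * U)"
  note A'h = A'h[folded A'_def] and col0 = col0[folded A'_def] and row0 = row0[folded A'_def]
  have A': "A' \<in> carrier_mat N N" using A Uc by (auto simp: A'_def)
  define B where "B = mat n n (\<lambda>(i, j). A' $$ (Suc i, Suc j))"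
  have "mat_adjoint B = B"
  proof (rule eq_matI)
    fix i j assume "i < dim_row B" "j < dim_col B"
    then show "mat_adjoint B $$ (i, j) = B $$ (i, j)"
      using adj_index[of "Suc i" A' "Suc j"] A' A'h by (auto simp: B_def N_def)
  qed (auto simp: B_def)
  then obtain V f where V: "unitary n V" "B = V * mat_diag n f * mat_adjoint V"
    using Suc.IH[of B] by (auto simp: B_def)
  have Vc: "V \<in> carrier_mat n n" "mat_adjoint V * V = 1\<^sub>m n" using V by (auto simp: unitary_def)
  let ?fb = "\<lambda>X Y. four_block_mat X (0\<^sub>m 1 n) (0\<^sub>m n 1) Y :: complex mat"
  \<comment> \<open>The eigenvector already split off is left alone, and the rest is rotated by
    \<open>V\<close>.\<close>
  define V' where "V' = ?fb (1\<^sub>m 1) V"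
  have V'c: "V' \<in> carrier_mat N N" using Vc by (auto simp: V'_def N_def)
  have V'adj: "mat_adjoint V' = ?fb (1\<^sub>m 1) (mat_adjoint V)"
    unfolding V'_def using Vc(1) by (subst four_block_adj[of _ 1 1 _ n _ n]) auto
  have mult: "?fb X Y * ?fb X' Y' = ?fb (X * X') (Y * Y')"
    if "X \<in> carrier_mat 1 1" "X' \<in> carrier_mat 1 1" "Y \<in> carrier_mat n n" "Y' \<in> carrier_mat n n" for X X' Y Y'
    using that by (subst mult_four_block_mat[of _ 1 1 _ n _ n _ _ 1 _ n]) simp_all
  have "mat_adjoint V' * V' = 1\<^sub>m N"
    unfolding V'adj unfolding V'_def using Vc by (subst mult) (auto simp: N_def)
  then have V'u: "unitary N V'" by (intro unitaryI V'c)
  define g where "g i = (case i of 0 \<Rightarrow> e | Suc k \<Rightarrow> f k)" for i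
  have D: "mat_diag N g = ?fb (e \<cdot>\<^sub>m 1\<^sub>m 1) (mat_diag n f)"
    by (rule eq_matI) (auto simp: mat_diag_def g_def N_def split: nat.splits)
  have "V' * mat_diag N g * mat_adjoint V' = ?fb (e \<cdot>\<^sub>m 1\<^sub>m 1) B"
    unfolding V'adj D V(2) unfolding V'_def using Vc(1) by (simp add: mult del: One_nat_def)
  also have "\<dots> = A'"
    by (rule eq_matI, insert A', auto simp: B_def col0 row0 N_def)
  finally have A'eq: "A' = V' * mat_diag N g * mat_adjoint V'" ..
  have "A = U * A' * mat_adjoint U"
    using A Uc unitary_def[of N U] U by (simp add: A'_def assoc_mult_mat[of _ N N _ N _ N] unitary_cancel[OF U, of _ N])
  also have "\<dots> = (U * V') * mat_diag N g * mat_adjoint (U * V')"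
  proof -
    define D where "D = mat_diag N g"
    have "D \<in> carrier_mat N N" by (simp add: D_def)
    then show ?thesis
      using Uc V'c unfolding A'eq D_def[symmetric] by (simp add: adj_mult[of _ N N _ N] assoc_mult_mat[of _ N N _ N _ N])
  qed
  finally show ?case using unitary_mult[OF U V'u] unfolding N_def by blast
qed

section \<open>Functional calculus and fidelity\<close>

text \<open>\<open>f\<close> is indexed by eigenvector, not by eigenvalue, so matrices built on the
  same \<open>V\<close> add and multiply pointwise and repeated eigenvalues raise no question of
  well-definedness.\<close>

definition fun_calc :: "nat \<Rightarrow> complex mat \<Rightarrow> (nat \<Rightarrow> complex) \<Rightarrow> complex mat" where
  "fun_calc n V f = V * mat_diag n f * mat_adjoint V"

lemma fun_calc_carrier: "unitary n V \<Longrightarrow> fun_calc n V f \<in> carrier_mat n n"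
  unfolding unitary_def fun_calc_def by auto

lemma mat_diag_adj: "mat_adjoint (mat_diag n f) = mat_diag n (\<lambda>i. cnj (f i))"
  by (rule eq_matI) (auto simp: mat_diag_def)

lemma fun_calc_cong: "(\<And>i. i < n \<Longrightarrow> f i = g i) \<Longrightarrow> fun_calc n V f = fun_calc n V g"
  unfolding fun_calc_def mat_diag_def by (intro arg_cong2[where f = times] refl eq_matI) auto

lemma fun_calc_mult:
  assumes "unitary n V"
  shows "fun_calc n V f * fun_calc n V g = fun_calc n V (\<lambda>i. f i * g i)"
proof -
  have V: "V \<in> carrier_mat n n" "mat_adjoint V * V = 1\<^sub>m n" using assms by (auto simp: unitary_def)
  have D: "(V * D * mat_adjoint V) * (V * D' * mat_adjoint V) = V * (D * D') * mat_adjoint V"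
    if "D \<in> carrier_mat n n" "D' \<in> carrier_mat n n" for D D'
    using that V(1) by (simp add: assoc_mult_mat[of _ n n _ n _ n] unitary_cancel[OF assms, of _ n])
  show ?thesis
    unfolding fun_calc_def by (subst D) simp_all
qed

lemma fun_calc_adj:
  assumes "unitary n V"
  shows "mat_adjoint (fun_calc n V f) = fun_calc n V (\<lambda>i. cnj (f i))"
proof -
  have V: "V \<in> carrier_mat n n" using assms by (auto simp: unitary_def)
  have "mat_adjoint (V * D * mat_adjoint V) = V * mat_adjoint D * mat_adjoint V"
    if "D \<in> carrier_mat n n" for D
    using that V by (simp add: adj_mult[of _ n n _ n] assoc_mult_mat[of _ n n _ n _ n])
  from this[OF mat_diag_dim] show ?thesis
    unfolding fun_calc_def mat_diag_adj .
qed

lemma fun_calc_add: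
  assumes "unitary n V"
  shows "fun_calc n V f + fun_calc n V g = fun_calc n V (\<lambda>i. f i + g i)"
proof -
  have V: "V \<in> carrier_mat n n" using assms by (auto simp: unitary_def)
  have "mat_diag n (\<lambda>i. f i + g i) = mat_diag n f + mat_diag n g"
    by (rule eq_matI) (auto simp: mat_diag_def)
  moreover have "V * (D + D') * mat_adjoint V = V * D * mat_adjoint V + V * D' * mat_adjoint V"
    if "D \<in> carrier_mat n n" "D' \<in> carrier_mat n n" for D D'
    using that V by (simp add: mult_add_distrib_mat[of _ n n _ n] add_mult_distrib_mat[of _ n n _ _ n])
  ultimately show ?thesis
    unfolding fun_calc_def by (metis mat_diag_dim)
qed

lemma fun_calc_smult:
  assumes "unitary n V"
  shows "c \<cdot>\<^sub>m fun_calc n V f = fun_calc n V (\<lambda>i. c * f i)"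
proof -
  have V: "V \<in> carrier_mat n n" using assms by (auto simp: unitary_def)
  have "mat_diag n (\<lambda>i. c * f i) = c \<cdot>\<^sub>m mat_diag n f"
    by (rule eq_matI) (auto simp: mat_diag_def)
  moreover have "V * (c \<cdot>\<^sub>m D) * mat_adjoint V = c \<cdot>\<^sub>m (V * D * mat_adjoint V)"
    if "D \<in> carrier_mat n n" for D
    using that V by (simp add: mult_smult_distrib[of _ n n _ n] mult_smult_assoc_mat[of _ n n _ n])
  ultimately show ?thesis
    unfolding fun_calc_def by (metis mat_diag_dim)
qed

lemma fun_calc_one: "unitary n V \<Longrightarrow> fun_calc n V (\<lambda>_. 1) = 1\<^sub>m n"
  unfolding unitary_def fun_calc_def by auto

lemma fun_calc_trace:
  assumes "unitary n V"
  shows "mtrace (fun_calc n V f) = (\<Sum>i<n. f i)"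
proof -
  have V: "V \<in> carrier_mat n n" "mat_adjoint V * V = 1\<^sub>m n" using assms by (auto simp: unitary_def)
  have "mtrace (fun_calc n V f) = mtrace (mat_adjoint V * (V * mat_diag n f))"
    unfolding fun_calc_def using V(1) by (intro mtrace_comm[of _ n n]) auto
  also have "mat_adjoint V * (V * mat_diag n f) = mat_diag n f"
    using V(1) by (intro unitary_cancel[OF assms, of _ n]) simp
  finally show ?thesis by (simp add: mtrace_def mat_diag_def)
qed

lemma fun_calc_psd:
  assumes "unitary n V" "\<And>i. i < n \<Longrightarrow> 0 \<le> f i"
  shows "psd (fun_calc n V f)"
proof -
  \<comment> \<open>\<open>f i\<close> is real by the order on complex numbers, so the root of its
    real part suffices.\<close>
  let ?s = "\<lambda>i. complex_of_real (sqrt (Re (f i)))"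
  have "fun_calc n V ?s * mat_adjoint (fun_calc n V ?s) = fun_calc n V f"
    unfolding fun_calc_adj[OF assms(1)] fun_calc_mult[OF assms(1)]
    by (rule fun_calc_cong) (use assms(2) in \<open>auto simp: less_eq_complex_def complex_eq_iff simp flip: of_real_mult\<close>)
  then show ?thesis using psd_gram[OF fun_calc_carrier[OF assms(1)], of ?s] by simp
qed

lemma psd_diagonalize:
  assumes A: "A \<in> carrier_mat n n" and "psd A"
  obtains V f where "unitary n V" "A = fun_calc n V (\<lambda>i. complex_of_real (f i))" "\<And>i. i < n \<Longrightarrow> 0 \<le> f i"
proof -
  from hermitian_diagonalizable[OF A psd_hermitian[OF \<open>psd A\<close>]] obtain V f
    where V: "unitary n V" and eq: "A = fun_calc n V f" unfolding fun_calc_def by blast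
  have Vc: "V \<in> carrier_mat n n" "mat_adjoint V * V = 1\<^sub>m n" using V by (auto simp: unitary_def)
  have f: "0 \<le> f i" if i: "i < n" for i
  proof -
    \<comment> \<open>\<open>?g\<close> selects the projection onto the \<open>i\<close>-th
      eigenvector; the compression of \<open>A\<close> by it is positive and has trace
      \<open>f i\<close>.\<close>
    let ?g = "\<lambda>j. if j = i then 1 else 0 :: complex"
    have "0 \<le> mtrace (mat_adjoint (fun_calc n V ?g) * A * fun_calc n V ?g)"
      using A fun_calc_carrier[OF V, of ?g] \<open>psd A\<close> by (intro mtrace_psd[of _ n] psd_conj) auto
    also have "mat_adjoint (fun_calc n V ?g) * A * fun_calc n V ?g = fun_calc n V (\<lambda>j. if j = i then f i else 0)"
      unfolding eq fun_calc_adj[OF V] fun_calc_mult[OF V] by (rule fun_calc_cong) auto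
    finally show ?thesis using i by (simp add: fun_calc_trace[OF V])
  qed
  show thesis
  proof (rule that[OF V])
    show "A = fun_calc n V (\<lambda>i. complex_of_real (Re (f i)))"
      unfolding eq by (rule fun_calc_cong) (use f in \<open>auto simp: less_eq_complex_def complex_eq_iff\<close>)
    show "0 \<le> Re (f i)" if "i < n" for i using f[OF that] by (simp add: less_eq_complex_def)
  qed
qed

section \<open>Positive square roots\<close>

lemma psd_factor:
  assumes "A \<in> carrier_mat n n" "psd A"
  obtains C where "C \<in> carrier_mat n n" "psd C" "C * C = A"
proof -
  from psd_diagonalize[OF assms] obtain V f where V: "unitary n V"
    and A: "A = fun_calc n V (\<lambda>i. complex_of_real (f i))" and f: "\<And>i. i < n \<Longrightarrow> 0 \<le> f i" by metis
  let ?C = "fun_calc n V (\<lambda>i. complex_of_real (sqrt (f i)))"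
  have "?C * ?C = A"
    unfolding A fun_calc_mult[OF V]
    by (rule fun_calc_cong) (use f in \<open>auto simp flip: of_real_mult\<close>)
  moreover have "psd ?C"
    by (rule fun_calc_psd[OF V]) (use f in \<open>auto simp: less_eq_complex_def\<close>)
  ultimately show thesis using that fun_calc_carrier[OF V] by blast
qed

text \<open>Compare the two eigenbases through Z, the adjoint of V times U. Equal squares force
  f_i^2 Z_ij = Z_ij g_j^2, so wherever Z_ij is nonzero the nonnegative numbers f_i and g_j agree.
  Hence f_i Z_ij = Z_ij g_j throughout, which is B = C after undoing the bases.\<close>

lemma psd_sqrt_unique:
  assumes B: "B \<in> carrier_mat n n" "psd B" and C: "C \<in> carrier_mat n n" "psd C" and BC: "B * B = C * C"
  shows "B = C"
proof -
  from psd_diagonalize[OF B] obtain V f where V: "unitary n V"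
    and Bf: "B = fun_calc n V (\<lambda>i. complex_of_real (f i))" and f: "\<And>i. i < n \<Longrightarrow> 0 \<le> f i" by metis
  from psd_diagonalize[OF C] obtain U g where U: "unitary n U"
    and Cg: "C = fun_calc n U (\<lambda>i. complex_of_real (g i))" and g: "\<And>i. i < n \<Longrightarrow> 0 \<le> g i" by metis
  have Vc: "V \<in> carrier_mat n n" "mat_adjoint V * V = 1\<^sub>m n" "V * mat_adjoint V = 1\<^sub>m n"
    using V by (auto simp: unitary_def)
  have Uc: "U \<in> carrier_mat n n" "mat_adjoint U * U = 1\<^sub>m n" "U * mat_adjoint U = 1\<^sub>m n"
    using U by (auto simp: unitary_def)
  define Z where "Z = mat_adjoint V * U"
  have Z: "Z \<in> carrier_mat n n" using Vc Uc by (auto simp: Z_def)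
  have L: "mat_adjoint V * fun_calc n V h * U = mat_diag n h * Z" for h
  proof -
    have "mat_adjoint V * (V * D * mat_adjoint V) * U = D * (mat_adjoint V * U)"
      if "D \<in> carrier_mat n n" for D
      using that Vc(1) Uc(1) by (simp add: assoc_mult_mat[of _ n n _ n _ n] unitary_cancel[OF V, of _ n])
    then show ?thesis by (simp add: Z_def fun_calc_def)
  qed
  have R: "mat_adjoint V * fun_calc n U h * U = Z * mat_diag n h" for h
  proof -
    have "mat_adjoint V * (U * D * mat_adjoint U) * U = mat_adjoint V * U * D"
      if "D \<in> carrier_mat n n" for D
      using that Vc(1) Uc(1,2) by (simp add: assoc_mult_mat[of _ n n _ n _ n])
    then show ?thesis by (simp add: Z_def fun_calc_def)
  qed
  have "mat_adjoint V * (B * B) * U = mat_adjoint V * (C * C) * U" using BC by simp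
  then have sq: "mat_diag n (\<lambda>i. complex_of_real (f i) * complex_of_real (f i)) * Z =
      Z * mat_diag n (\<lambda>i. complex_of_real (g i) * complex_of_real (g i))"
    unfolding Bf Cg fun_calc_mult[OF V] fun_calc_mult[OF U] L R .
  have entry: "complex_of_real (f i) * Z $$ (i, j) = Z $$ (i, j) * complex_of_real (g j)" if ij: "i < n" "j < n" for i j
  proof (cases "Z $$ (i, j) = 0")
    case False
    have "(mat_diag n (\<lambda>i. complex_of_real (f i) * complex_of_real (f i)) * Z) $$ (i, j) =
        (Z * mat_diag n (\<lambda>i. complex_of_real (g i) * complex_of_real (g i))) $$ (i, j)"
      by (simp only: sq)
    then have "complex_of_real (f i * f i) = complex_of_real (g j * g j)"
      using ij False by (simp add: mat_diag_mult_left[OF Z] mat_diag_mult_right[OF Z])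
    then have "f i * f i = g j * g j" by (simp only: of_real_eq_iff)
    then have "f i = g j" using f[OF ij(1)] g[OF ij(2)]
      by (metis abs_of_nonneg real_sqrt_mult_self real_sqrt_abs2)
    then show ?thesis by simp
  qed simp
  have "mat_adjoint V * B * U = mat_adjoint V * C * U"
    unfolding Bf Cg L R by (rule eq_matI)
      (use entry Z in \<open>auto simp: mat_diag_mult_left[OF Z] mat_diag_mult_right[OF Z]\<close>)
  then have "V * (mat_adjoint V * B * U) * mat_adjoint U = V * (mat_adjoint V * C * U) * mat_adjoint U" by simp
  moreover have "V * (mat_adjoint V * M * U) * mat_adjoint U = M" if M: "M \<in> carrier_mat n n" for M
    using Vc(1) Uc(1,3) M by (simp add: assoc_mult_mat[of _ n n _ n _ n] unitary_cancel[OF V, of _ n])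
  ultimately show ?thesis using B(1) C(1) by simp
qed

text \<open>Existence from \<open>psd_factor\<close> and uniqueness from
  \<open>psd_sqrt_unique\<close> evaluate the definite description. Positivity includes being
  square, so fixing the row count fixes the format.\<close>

lemma msqrt:
  assumes A: "A \<in> carrier_mat n n" "psd A"
  shows "msqrt A \<in> carrier_mat n n" "psd (msqrt A)" "msqrt A * msqrt A = A"
proof -
  have sq: "psd B \<Longrightarrow> dim_row B = n \<Longrightarrow> B \<in> carrier_mat n n" for B
    by (auto simp: psd_def hermitian_def)
  have "\<exists>!B. psd B \<and> dim_row B = dim_row A \<and> B * B = A"
  proof -
    obtain C where "C \<in> carrier_mat n n" "psd C" "C * C = A" using psd_factor[OF A] .
    then show ?thesis using A psd_sqrt_unique[of _ n] sq by (intro ex1I[of _ C]) auto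
  qed
  from theI'[OF this] have "psd (msqrt A) \<and> dim_row (msqrt A) = dim_row A \<and> msqrt A * msqrt A = A"
    unfolding msqrt_def .
  then show "msqrt A \<in> carrier_mat n n" "psd (msqrt A)" "msqrt A * msqrt A = A"
    using sq A by auto
qed

section \<open>Fidelity as a maximum over positive block matrices\<close>

lemma mtrace_mult_psd:
  assumes A: "A \<in> carrier_mat n n" "psd A" and B: "B \<in> carrier_mat n n" "psd B"
  shows "0 \<le> mtrace (A * B)"
proof -
  obtain C where C: "C \<in> carrier_mat n n" "psd C" "C * C = B" using psd_factor[OF B] .
  have "mtrace (A * B) = mtrace (A * C * C)"
    using A C by (simp add: assoc_mult_mat[of _ n n _ n _ n])
  also have "\<dots> = mtrace (C * (A * C))"
    using A C by (intro mtrace_comm[of _ n n]) auto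
  also have "C * (A * C) = mat_adjoint C * A * C"
    using A C by (simp add: psd_hermitian assoc_mult_mat[of _ n n _ n _ n])
  also have "0 \<le> mtrace \<dots>"
    using A C by (intro mtrace_psd[of _ n] psd_conj) auto
  finally show ?thesis .
qed

text \<open>Put \<open>A = R * S\<close>, so that \<open>A\<^sup>\<dagger> A = P * P\<close>, and
  let \<open>U = A * Q\<close> be the partial isometry of the polar decomposition. With X =
  \<open>S * mat_adjoint U * R\<close>, cyclicity gives tr X = tr (\<open>mat_adjoint U * A\<close>)
  = tr (Q P P) = tr P. Positivity is shown by writing the block matrix as \<open>K\<close> times its
  adjoint.\<close>

lemma fidelity_attained:
  assumes \<rho>: "\<rho> \<in> carrier_mat d d" "psd \<rho>" and \<sigma>: "\<sigma> \<in> carrier_mat d d" "psd \<sigma>"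
  obtains X where "X \<in> carrier_mat d d" "psd (four_block_mat \<rho> X (mat_adjoint X) \<sigma>)"
    "Re (mtrace X) = fidelity \<rho> \<sigma>"
proof -
  note assoc = assoc_mult_mat[of _ d d _ d _ d] and adj = adj_mult[of _ d d _ d]
  define S where "S = msqrt \<rho>"
  define R where "R = msqrt \<sigma>"
  define M where "M = S * \<sigma> * S"
  define P where "P = msqrt M"
  have S: "S \<in> carrier_mat d d" "psd S" "S * S = \<rho>" "mat_adjoint S = S"
    using msqrt[OF \<rho>] psd_hermitian by (auto simp: S_def)
  have R: "R \<in> carrier_mat d d" "psd R" "R * R = \<sigma>" "mat_adjoint R = R"
    using msqrt[OF \<sigma>] psd_hermitian by (auto simp: R_def)
  have M: "M \<in> carrier_mat d d" "psd M"
    using psd_conj[OF \<sigma> S(1)] S \<sigma> by (auto simp: M_def)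
  have P: "P \<in> carrier_mat d d" "psd P" "P * P = M"
    using msqrt[OF M] by (auto simp: P_def)
  from psd_diagonalize[OF P(1,2)] obtain V f where V: "unitary d V"
    and Pf: "P = fun_calc d V (\<lambda>i. complex_of_real (f i))" by metis
  txt \<open>Moore--Penrose inverse of \<open>P\<close>, using \<open>inverse 0 = 0\<close>.\<close>
  define Q where "Q = fun_calc d V (\<lambda>i. complex_of_real (inverse (f i)))"
  have Q: "Q \<in> carrier_mat d d" "mat_adjoint Q = Q"
    by (simp_all add: Q_def fun_calc_carrier[OF V] fun_calc_adj[OF V])
  have QPPQQ: "Q * (P * P * (Q * Q)) = Q"
    unfolding Q_def Pf fun_calc_mult[OF V]
  proof (rule fun_calc_cong)
    fix i
    show "complex_of_real (inverse (f i)) * (complex_of_real (f i) * complex_of_real (f i) *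
        (complex_of_real (inverse (f i)) * complex_of_real (inverse (f i)))) = complex_of_real (inverse (f i))"
      by (cases "f i = 0") (simp_all add: field_simps)
  qed
  have QPP: "Q * (P * P) = P"
    unfolding Q_def Pf fun_calc_mult[OF V]
  proof (rule fun_calc_cong)
    fix i
    show "complex_of_real (inverse (f i)) * (complex_of_real (f i) * complex_of_real (f i)) = complex_of_real (f i)"
      by (cases "f i = 0") simp_all
  qed
  define A where "A = R * S"
  have A: "A \<in> carrier_mat d d" using R S by (simp add: A_def)
  have AA: "mat_adjoint A * A = P * P"
    using R(1) S(1) \<sigma> by (simp add: A_def adj R(4) S(4) P(3) M_def assoc flip: R(3))
  define U where "U = A * Q"
  have U: "U \<in> carrier_mat d d" using A Q by (simp add: U_def)
  \<comment> \<open>\<open>E\<close> is the projection onto the range of \<open>U\<close>, and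
    \<open>N\<close> below is its complement. For singular \<open>P\<close> the matrix
    \<open>U\<close> is not unitary, and \<open>N\<close> makes up the missing part of
    \<sigma>.\<close>
  define E where "E = U * mat_adjoint U"
  have E: "E \<in> carrier_mat d d" "mat_adjoint E = E" using U by (simp_all add: E_def adj)
  have EE: "E * E = E"
  proof -
    have "E * E = A * ((Q * ((Q * ((mat_adjoint A * A) * (Q * Q))) * mat_adjoint A)))"
      using A Q by (simp add: E_def U_def adj assoc)
    also have "\<dots> = E" unfolding AA QPPQQ using A Q by (simp add: E_def U_def adj assoc)
    finally show ?thesis .
  qed
  define N where "N = 1\<^sub>m d - E"
  have N: "N \<in> carrier_mat d d" "mat_adjoint N = N"
  proof -
    show N: "N \<in> carrier_mat d d" using E by (simp add: N_def minus_carrier_mat)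
    have "cnj (E $$ (j, i)) = E $$ (i, j)" if "i < d" "j < d" for i j
      using adj_index[of i E j] E that by simp
    then show "mat_adjoint N = N" using E N by (intro eq_matI) (auto simp: N_def)
  qed
  have NN: "N * N = N"
  proof -
    have "N * E = E - E"
      unfolding N_def using E EE minus_mult_distrib_mat[of "1\<^sub>m d" d d E E d] by simp
    then have "N * N = N - (E - E)"
      using E N mult_minus_distrib_mat[of N d d "1\<^sub>m d" d E] by (simp add: N_def)
    then show ?thesis using E N by (auto intro!: eq_matI)
  qed
  define X where "X = S * mat_adjoint U * R"
  have X: "X \<in> carrier_mat d d" "mat_adjoint X = R * U * S"
    using S R U by (simp_all add: X_def adj assoc)
  \<comment> \<open>The second block row has Gram matrix R (E + N) R = R R = \<sigma>, as
    \<open>N\<close> is a projection; the zero above \<open>R * N\<close> keeps the off-diagonal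
    block equal to \<open>X\<close>.\<close>
  define K where "K = four_block_mat S (0\<^sub>m d d) (R * U) (R * N)"
  have K: "K \<in> carrier_mat (d + d) (d + d)" using S R U N by (simp add: K_def)
  have "K * mat_adjoint K = four_block_mat (S * S) (S * mat_adjoint (R * U)) (R * U * S) (R * U * mat_adjoint (R * U) + R * N * mat_adjoint (R * N))"
    unfolding K_def using S R U N \<rho>(1)
    by (subst four_block_adj[of _ d d _ d _ d], simp_all, subst mult_four_block_mat[of _ d d _ d _ d _ _ d _ d])
      simp_all
  also have "S * mat_adjoint (R * U) = X"
    using R U S by (simp add: X_def adj assoc)
  also have "R * U * mat_adjoint (R * U) + R * N * mat_adjoint (R * N) = \<sigma>"
  proof -
    have "R * U * mat_adjoint (R * U) = R * E * R" using R U by (simp add: adj E_def assoc)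
    moreover have "R * N * mat_adjoint (R * N) = R * (N * N) * R" using R(1,4) N by (simp add: adj assoc)
    moreover have "R * E * R + R * N * R = R * (E + N) * R"
      using R E N by (simp add: mult_add_distrib_mat[of _ d d _ d] add_mult_distrib_mat[of _ d d _ _ d])
    moreover have "E + N = 1\<^sub>m d" using E by (auto simp: N_def intro!: eq_matI)
    ultimately show ?thesis using R NN by simp
  qed
  finally have "psd (four_block_mat \<rho> X (mat_adjoint X) \<sigma>)"
    using psd_gram[OF K] by (simp add: S(3) X(2))
  moreover have "mtrace X = mtrace P"
  proof -
    have "mtrace X = mtrace (R * (S * mat_adjoint U))"
      unfolding X_def using S R U by (intro mtrace_comm[of _ d d]) auto
    also have "R * (S * mat_adjoint U) = A * mat_adjoint U"
      using S R U by (simp add: A_def assoc)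
    also have "mtrace \<dots> = mtrace (mat_adjoint U * A)"
      using A U by (intro mtrace_comm[of _ d d]) auto
    also have "mat_adjoint U * A = Q * (mat_adjoint A * A)"
      using A Q by (simp add: U_def adj assoc)
    finally show ?thesis by (simp only: AA QPP)
  qed
  then have "Re (mtrace X) = fidelity \<rho> \<sigma>"
    by (simp add: fidelity_def P_def M_def S_def)
  ultimately show thesis using that X(1) by blast
qed

text \<open>Weak duality. In the trace of the conjugated block matrix, cyclicity turns the cross
  term tr (\<open>mat_adjoint a * X * b\<close>) into tr (\<open>X * b * mat_adjoint a\<close>) = tr
  X. The left side is thus independent of \<open>a\<close> and \<open>b\<close>, which stay free to
  be optimised.\<close>

lemma block_psd_trace:
  assumes c: "\<rho> \<in> carrier_mat d d" "X \<in> carrier_mat d d" "\<sigma> \<in> carrier_mat d d"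
    and psd: "psd (four_block_mat \<rho> X (mat_adjoint X) \<sigma>)"
    and ab: "a \<in> carrier_mat d d" "b \<in> carrier_mat d d" "b * mat_adjoint a = 1\<^sub>m d"
  shows "2 * Re (mtrace X) \<le> Re (mtrace (\<rho> * (a * mat_adjoint a))) + Re (mtrace (\<sigma> * (b * mat_adjoint b)))"
proof -
  note assoc = assoc_mult_mat[of _ d d _ d _ d] and adj = adj_mult[of _ d d _ d]
  let ?B = "four_block_mat \<rho> X (mat_adjoint X) \<sigma>"
  \<comment> \<open>The column (a, -b) is padded by zero blocks to a square matrix; the conjugated
    matrix then has \<open>T\<close> as its only possibly nonzero block.\<close>
  define N where "N = four_block_mat a (0\<^sub>m d d) (- b) (0\<^sub>m d d)"
  have N: "N \<in> carrier_mat (d + d) (d + d)" using ab by (simp add: N_def)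
  have B: "?B \<in> carrier_mat (d + d) (d + d)" using c by simp
  have adjN: "mat_adjoint N = four_block_mat (mat_adjoint a) (- mat_adjoint b) (0\<^sub>m d d) (0\<^sub>m d d)"
    unfolding N_def using ab(1,2)
    by (subst four_block_adj[of _ d d _ d _ d]) (auto intro!: cong_four_block_mat eq_matI)
  define P1 where "P1 = mat_adjoint a * \<rho> + - (mat_adjoint b * mat_adjoint X)"
  define P2 where "P2 = mat_adjoint a * X + - (mat_adjoint b * \<sigma>)"
  define T where "T = P1 * a + - (P2 * b)"
  have P: "P1 \<in> carrier_mat d d" "P2 \<in> carrier_mat d d"
    using ab c by (simp_all add: P1_def P2_def)
  have T: "T \<in> carrier_mat d d" using ab P by (simp add: T_def)
  have NB: "mat_adjoint N * ?B = four_block_mat P1 P2 (0\<^sub>m d d) (0\<^sub>m d d)"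
    unfolding adjN using c ab(1,2)
    by (subst mult_four_block_mat[of _ d d _ d _ d _ _ d _ d]) (simp_all add: P1_def P2_def)
  have z: "- (0\<^sub>m d d :: complex mat) = 0\<^sub>m d d" by (rule eq_matI) auto
  have "four_block_mat P1 P2 (0\<^sub>m d d) (0\<^sub>m d d) * N = four_block_mat T (0\<^sub>m d d) (0\<^sub>m d d) (0\<^sub>m d d)"
    unfolding N_def using P ab(1,2)
    by (subst mult_four_block_mat[of _ d d _ d _ d _ _ d _ d]) (simp_all add: T_def z)
  then have "mat_adjoint N * ?B * N = four_block_mat T (0\<^sub>m d d) (0\<^sub>m d d) (0\<^sub>m d d)"
    unfolding NB .
  moreover have "0 \<le> mtrace (mat_adjoint N * ?B * N)"
    by (intro mtrace_psd[of _ "d + d"] psd_conj[OF B psd N]) (use N B in auto)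
  moreover have "mtrace (four_block_mat T (0\<^sub>m d d) (0\<^sub>m d d) (0\<^sub>m d d)) = mtrace T"
  proof -
    have "mtrace (four_block_mat T (0\<^sub>m d d) (0\<^sub>m d d) (0\<^sub>m d d)) = (\<Sum>i<d + d. if i < d then T $$ (i, i) else 0)"
      using T by (subst mtrace_carrier[of _ "d + d" "d + d"]) (auto intro!: sum.cong)
    also have "\<dots> = (\<Sum>i<d. T $$ (i, i))"
      by (rule sum.mono_neutral_cong_right) auto
    finally show ?thesis using T by (simp add: mtrace_carrier)
  qed
  ultimately have "0 \<le> mtrace T" by simp
  also have "mtrace T = (mtrace (mat_adjoint a * \<rho> * a) - mtrace (mat_adjoint b * mat_adjoint X * a))
      - (mtrace (mat_adjoint a * X * b) - mtrace (mat_adjoint b * \<sigma> * b))"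
  proof -
    define A1 A2 A3 A4 where "A1 = mat_adjoint a * \<rho>" and "A2 = mat_adjoint b * mat_adjoint X"
      and "A3 = mat_adjoint a * X" and "A4 = mat_adjoint b * \<sigma>"
    have A: "A1 \<in> carrier_mat d d" "A2 \<in> carrier_mat d d" "A3 \<in> carrier_mat d d" "A4 \<in> carrier_mat d d"
      using c ab(1,2) by (simp_all add: A1_def A2_def A3_def A4_def)
    have "T = (A1 + - A2) * a + - ((A3 + - A4) * b)"
      by (simp add: T_def P1_def P2_def A1_def A2_def A3_def A4_def)
    also have "\<dots> = (A1 * a + - (A2 * a)) + (- (A3 * b) + A4 * b)"
      using A ab(1,2) by (simp add: add_mult_distrib_mat[of _ d d _ _ d]) (auto intro!: eq_matI)
    finally have T_eq: "T = \<dots>" .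
    have tr: "mtrace (- Y) = - mtrace Y" if "Y \<in> carrier_mat d d" for Y
      using that by (simp add: mtrace_def sum_negf)
    have "mtrace T = (mtrace (A1 * a) - mtrace (A2 * a)) + (- mtrace (A3 * b) + mtrace (A4 * b))"
      unfolding T_eq using A ab(1,2) by (simp add: mtrace_add[of _ d] tr)
    then show ?thesis by (simp add: A1_def A2_def A3_def A4_def)
  qed
  also have "mtrace (mat_adjoint a * \<rho> * a) = mtrace (\<rho> * (a * mat_adjoint a))"
    using c ab(1,2) mtrace_comm[of "mat_adjoint a" d d "\<rho> * a"] by (simp add: assoc)
  also have "mtrace (mat_adjoint b * \<sigma> * b) = mtrace (\<sigma> * (b * mat_adjoint b))"
    using c ab(1,2) mtrace_comm[of "mat_adjoint b" d d "\<sigma> * b"] by (simp add: assoc)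
  also have x: "mtrace (mat_adjoint a * X * b) = mtrace X"
  proof -
    have "mtrace (mat_adjoint a * X * b) = mtrace (X * b * mat_adjoint a)"
      using c ab(1,2) mtrace_comm[of "mat_adjoint a" d d "X * b"] by (simp add: assoc)
    then show ?thesis using c ab by (simp add: assoc)
  qed
  also have "mtrace (mat_adjoint b * mat_adjoint X * a) = cnj (mtrace X)"
    using c ab(1,2) mtrace_adj[of "mat_adjoint a * X * b" d] x by (simp add: adj assoc)
  finally show ?thesis by (simp add: less_eq_complex_def)
qed

lemma of_real_right_inverse: "0 < x \<Longrightarrow> complex_of_real x * complex_of_real (inverse x) = 1"
  by (simp flip: of_real_mult)

lemma of_real_left_inverse: "0 < x \<Longrightarrow> complex_of_real (inverse x) * complex_of_real x = 1"
  by (simp flip: of_real_mult)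

text \<open>Take a = T^-1 Q^(1/2) and b = T Q^(-1/2) with T = S + \<delta> and Q = P + \<epsilon>,
  so that \<open>a a\<^sup>\<dagger> = Ti * Q * Ti\<close> and
  \<open>b b\<^sup>\<dagger> = T * Qi * T\<close>. The first trace of the pairing is at most tr Q;
  the second is at most tr P plus terms that vanish with \<delta>.\<close>

lemma fidelity_upper:
  assumes \<rho>: "\<rho> \<in> carrier_mat d d" "psd \<rho>" and \<sigma>: "\<sigma> \<in> carrier_mat d d" "psd \<sigma>"
    and X: "X \<in> carrier_mat d d" "psd (four_block_mat \<rho> X (mat_adjoint X) \<sigma>)"
  shows "Re (mtrace X) \<le> fidelity \<rho> \<sigma>"
proof -
  note assoc = assoc_mult_mat[of _ d d _ d _ d] and adj = adj_mult[of _ d d _ d]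
  define S where "S = msqrt \<rho>"
  define M where "M = S * \<sigma> * S"
  define P where "P = msqrt M"
  have S: "S \<in> carrier_mat d d" "psd S" "S * S = \<rho>" "mat_adjoint S = S"
    using msqrt[OF \<rho>] psd_hermitian by (auto simp: S_def)
  have M: "M \<in> carrier_mat d d" "psd M"
    using psd_conj[OF \<sigma> S(1)] S \<sigma> by (auto simp: M_def)
  have P: "P \<in> carrier_mat d d" "psd P" "P * P = M"
    using msqrt[OF M] by (auto simp: P_def)
  from psd_diagonalize[OF P(1,2)] obtain V f where V: "unitary d V"
    and Pf: "P = fun_calc d V (\<lambda>i. complex_of_real (f i))" and f: "\<And>i. i < d \<Longrightarrow> 0 \<le> f i" by metis
  from psd_diagonalize[OF S(1,2)] obtain U s where U: "unitary d U"
    and Sf: "S = fun_calc d U (\<lambda>i. complex_of_real (s i))" and s: "\<And>i. i < d \<Longrightarrow> 0 \<le> s i" by metis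
  have trP: "Re (mtrace P) = (\<Sum>i<d. f i)" by (simp add: Pf fun_calc_trace[OF V])
  \<comment> \<open>The error term comes from tr Q = tr P + d \<epsilon>.\<close>
  have main: "2 * Re (mtrace X) \<le> 2 * Re (mtrace P) + real d * \<epsilon>" if eps: "\<epsilon> > 0" for \<epsilon> :: real
  proof -
    define Q where "Q = fun_calc d V (\<lambda>i. complex_of_real (f i + \<epsilon>))"
    define Qi where "Qi = fun_calc d V (\<lambda>i. complex_of_real (inverse (f i + \<epsilon>)))"
    define q where "q = fun_calc d V (\<lambda>i. complex_of_real (sqrt (f i + \<epsilon>)))"
    define qi where "qi = fun_calc d V (\<lambda>i. complex_of_real (inverse (sqrt (f i + \<epsilon>))))"
    have pos: "f i + \<epsilon> > 0" if "i < d" for i using f[OF that] eps by simp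
    have Qs: "Q \<in> carrier_mat d d" "Qi \<in> carrier_mat d d" "q \<in> carrier_mat d d" "qi \<in> carrier_mat d d"
      by (simp_all add: Q_def Qi_def q_def qi_def fun_calc_carrier[OF V])
    have qadj: "mat_adjoint q = q" "mat_adjoint qi = qi"
      by (simp_all add: q_def qi_def fun_calc_adj[OF V])
    have qq: "q * q = Q" unfolding q_def Q_def fun_calc_mult[OF V]
      by (rule fun_calc_cong) (use pos in \<open>auto simp: less_imp_le simp flip: of_real_mult\<close>)
    have qiqi: "qi * qi = Qi" unfolding qi_def Qi_def fun_calc_mult[OF V]
      by (rule fun_calc_cong) (use pos in \<open>auto simp: less_imp_le simp flip: of_real_mult inverse_mult_distrib\<close>)
    have qiq: "qi * q = 1\<^sub>m d" unfolding qi_def q_def fun_calc_mult[OF V] fun_calc_one[OF V, symmetric]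
      by (rule fun_calc_cong) (use pos in \<open>force intro: of_real_left_inverse\<close>)
    have psdQ: "psd Q" unfolding Q_def
      by (rule fun_calc_psd[OF V]) (use pos in \<open>auto simp: less_eq_complex_def intro: less_imp_le\<close>)
    \<comment> \<open>\<open>c1\<close> and \<open>c2\<close> are the coefficients of \<delta> and
      its square in the trace of (S + \<delta>) \<sigma> (S + \<delta>) Qi. They depend on
      \<epsilon> through \<open>Qi\<close>, so \<delta> tends to zero while \<epsilon> is held
      fixed.\<close>
    define c1 where "c1 = Re (mtrace ((\<sigma> * S + S * \<sigma>) * Qi))"
    define c2 where "c2 = Re (mtrace (\<sigma> * Qi))"
    have step: "2 * Re (mtrace X) \<le> 2 * Re (mtrace P) + real d * \<epsilon> + \<delta> * c1 + \<delta>\<^sup>2 * c2" if del: "\<delta> > 0" for \<delta> :: real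
    proof -
      define T where "T = fun_calc d U (\<lambda>i. complex_of_real (s i + \<delta>))"
      define Ti where "Ti = fun_calc d U (\<lambda>i. complex_of_real (inverse (s i + \<delta>)))"
      have spos: "s i + \<delta> > 0" if "i < d" for i using s[OF that] del by simp
      have Ts: "T \<in> carrier_mat d d" "Ti \<in> carrier_mat d d" "mat_adjoint T = T" "mat_adjoint Ti = Ti"
        by (simp_all add: T_def Ti_def fun_calc_carrier[OF U] fun_calc_adj[OF U])
      have TTi: "T * Ti = 1\<^sub>m d" unfolding T_def Ti_def fun_calc_mult[OF U] fun_calc_one[OF U, symmetric]
        by (rule fun_calc_cong) (rule of_real_right_inverse[OF spos])
      have "(T * qi) * mat_adjoint (Ti * q) = T * ((qi * q) * Ti)"
        using Ts(1,2) Qs by (simp add: adj qadj Ts assoc)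
      also have "\<dots> = 1\<^sub>m d" using Ts(1,2) by (simp add: qiq TTi)
      finally have one: "(T * qi) * mat_adjoint (Ti * q) = 1\<^sub>m d" .
      have aa: "(Ti * q) * mat_adjoint (Ti * q) = Ti * Q * Ti"
        using Ts(1,2) Qs by (simp add: adj qadj Ts assoc flip: qq)
      have bb: "(T * qi) * mat_adjoint (T * qi) = T * Qi * T"
        using Ts(1,2) Qs by (simp add: adj qadj Ts assoc flip: qiqi)
      have "2 * Re (mtrace X) \<le> Re (mtrace (\<rho> * (Ti * Q * Ti))) + Re (mtrace (\<sigma> * (T * Qi * T)))"
        using block_psd_trace[OF \<rho>(1) X(1) \<sigma>(1) X(2) _ _ one] Ts(1,2) Qs unfolding aa bb by simp
      also have "Re (mtrace (\<rho> * (Ti * Q * Ti))) \<le> Re (mtrace Q)"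
      proof -
        have "mtrace (\<rho> * (Ti * Q * Ti)) = mtrace ((\<rho> * Ti * Q) * Ti)"
          using \<rho> Ts(1,2) Qs by (simp add: assoc)
        also have "\<dots> = mtrace (Ti * (\<rho> * Ti * Q))"
          using \<rho> Ts(1,2) Qs by (intro mtrace_comm[of _ d d]) auto
        also have "Ti * (\<rho> * Ti * Q) = (Ti * (S * S) * Ti) * Q"
          unfolding S(3) using \<rho> Ts(1,2) Qs by (simp add: assoc)
        finally have 1: "mtrace (\<rho> * (Ti * Q * Ti)) = mtrace ((Ti * (S * S) * Ti) * Q)" .
        \<comment> \<open>The eigenvalues of T^-1 \<rho> T^-1, namely s^2 / (s + \<delta>)^2 \<le>
          1. What is lost against tr Q is the trace of a product of two positive matrices.\<close>
        define w where "w i = inverse (s i + \<delta>) * (s i * s i) * inverse (s i + \<delta>)" for i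
        have 2: "Ti * (S * S) * Ti = fun_calc d U (\<lambda>i. complex_of_real (w i))"
          unfolding Ti_def Sf fun_calc_mult[OF U] by (simp add: w_def)
        have w: "w i \<le> 1" if "i < d" for i
        proof -
          have "s i * s i \<le> (s i + \<delta>) * (s i + \<delta>)"
            using s[OF that] del by (intro mult_mono) auto
          moreover have "w i = s i * s i / ((s i + \<delta>) * (s i + \<delta>))"
            by (simp add: w_def divide_inverse mult.assoc)
          ultimately show ?thesis using spos[OF that] by (simp only: divide_le_eq_1_pos mult_pos_pos)
        qed
        have "fun_calc d U (\<lambda>i. complex_of_real (w i)) + fun_calc d U (\<lambda>i. complex_of_real (1 - w i)) = 1\<^sub>m d"
          unfolding fun_calc_add[OF U] fun_calc_one[OF U, symmetric] by (rule fun_calc_cong) simp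
        then have "Q = fun_calc d U (\<lambda>i. complex_of_real (w i)) * Q + fun_calc d U (\<lambda>i. complex_of_real (1 - w i)) * Q"
          using Qs(1) by (simp add: fun_calc_carrier[OF U] flip: add_mult_distrib_mat[of _ d d _ _ d])
        then have "mtrace Q = mtrace (fun_calc d U (\<lambda>i. complex_of_real (w i)) * Q) + mtrace (fun_calc d U (\<lambda>i. complex_of_real (1 - w i)) * Q)"
          using Qs(1) fun_calc_carrier[OF U] by (metis mtrace_add mult_carrier_mat)
        moreover have "0 \<le> mtrace (fun_calc d U (\<lambda>i. complex_of_real (1 - w i)) * Q)"
          using w by (intro mtrace_mult_psd[of _ d] fun_calc_carrier[OF U] fun_calc_psd[OF U] Qs(1) psdQ)
            (auto simp: less_eq_complex_def)
        ultimately show ?thesis unfolding 1 2 by (simp add: less_eq_complex_def)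
      qed
      also have "Re (mtrace Q) = Re (mtrace P) + real d * \<epsilon>"
        by (simp add: Q_def trP fun_calc_trace[OF V] sum.distrib)
      also have "Re (mtrace (\<sigma> * (T * Qi * T))) \<le> Re (mtrace P) + \<delta> * c1 + \<delta>\<^sup>2 * c2"
      proof -
        have TS: "T = S + complex_of_real \<delta> \<cdot>\<^sub>m 1\<^sub>m d"
          unfolding T_def Sf fun_calc_one[OF U, symmetric] fun_calc_smult[OF U] fun_calc_add[OF U] by simp
        have "mtrace (\<sigma> * (T * Qi * T)) = mtrace ((\<sigma> * T * Qi) * T)"
          using \<sigma> Ts(1,2) Qs by (simp add: assoc)
        also have "\<dots> = mtrace (T * (\<sigma> * T * Qi))"
          using \<sigma> Ts(1,2) Qs by (intro mtrace_comm[of _ d d]) auto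
        also have "T * (\<sigma> * T * Qi) = (T * \<sigma> * T) * Qi"
          using \<sigma> Ts(1,2) Qs by (simp add: assoc)
        also have "T * \<sigma> * T = M + complex_of_real \<delta> \<cdot>\<^sub>m (\<sigma> * S + S * \<sigma>) + complex_of_real (\<delta>\<^sup>2) \<cdot>\<^sub>m \<sigma>"
        proof -
          have 1: "T * \<sigma> = S * \<sigma> + complex_of_real \<delta> \<cdot>\<^sub>m \<sigma>"
            unfolding TS using S(1) \<sigma>(1) by (simp add: add_mult_distrib_mat[of _ d d _ _ d] mult_smult_assoc_mat[of _ d d _ d])
          have 2: "T * \<sigma> * T = T * \<sigma> * S + complex_of_real \<delta> \<cdot>\<^sub>m (T * \<sigma>)"
            using S(1) \<sigma>(1) Ts(1) by (subst (2) TS) (simp add: mult_add_distrib_mat[of _ d d _ d] mult_smult_distrib[of _ d d _ d])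
          have 3: "T * \<sigma> * S = M + complex_of_real \<delta> \<cdot>\<^sub>m (\<sigma> * S)"
            unfolding 1 M_def using S(1) \<sigma>(1) by (simp add: add_mult_distrib_mat[of _ d d _ _ d] mult_smult_assoc_mat[of _ d d _ d])
          show ?thesis unfolding 2 3 unfolding 1 using S(1) \<sigma>(1) M(1)
            by (intro eq_matI) (auto simp: algebra_simps power2_eq_square simp del: index_mult_mat(1))
        qed
        also have "(M + complex_of_real \<delta> \<cdot>\<^sub>m (\<sigma> * S + S * \<sigma>) + complex_of_real (\<delta>\<^sup>2) \<cdot>\<^sub>m \<sigma>) * Qi
            = M * Qi + complex_of_real \<delta> \<cdot>\<^sub>m ((\<sigma> * S + S * \<sigma>) * Qi) + complex_of_real (\<delta>\<^sup>2) \<cdot>\<^sub>m (\<sigma> * Qi)"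
        proof -
          have "(M + a \<cdot>\<^sub>m G + b \<cdot>\<^sub>m H) * Qi = M * Qi + a \<cdot>\<^sub>m (G * Qi) + b \<cdot>\<^sub>m (H * Qi)"
            if "G \<in> carrier_mat d d" "H \<in> carrier_mat d d" for a b G H
          proof -
            have "(M + a \<cdot>\<^sub>m G + b \<cdot>\<^sub>m H) * Qi = (M + a \<cdot>\<^sub>m G) * Qi + b \<cdot>\<^sub>m H * Qi"
              using that M(1) Qs(2) by (intro add_mult_distrib_mat[of _ d d _ _ d]) auto
            also have "(M + a \<cdot>\<^sub>m G) * Qi = M * Qi + a \<cdot>\<^sub>m G * Qi"
              using that M(1) Qs(2) by (intro add_mult_distrib_mat[of _ d d _ _ d]) auto
            finally show ?thesis
              using mult_smult_assoc_mat[OF that(1) Qs(2)] mult_smult_assoc_mat[OF that(2) Qs(2)] by (simp only:)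
          qed
          then show ?thesis using S(1) \<sigma>(1) by simp
        qed
        also have "mtrace \<dots> = mtrace (M * Qi) + complex_of_real \<delta> * mtrace ((\<sigma> * S + S * \<sigma>) * Qi) + complex_of_real (\<delta>\<^sup>2) * mtrace (\<sigma> * Qi)"
          using M(1) S(1) \<sigma>(1) Qs by (intro mtrace_lin[of _ d]) auto
        finally have "Re (mtrace (\<sigma> * (T * Qi * T))) = Re (mtrace (M * Qi)) + \<delta> * c1 + \<delta>\<^sup>2 * c2"
          by (simp add: c1_def c2_def)
        \<comment> \<open>Since M = P P, the product has eigenvalues f^2 / (f + \<epsilon>), each at
          most f.\<close>
        moreover have "Re (mtrace (M * Qi)) \<le> Re (mtrace P)"
        proof -
          have "M * Qi = fun_calc d V (\<lambda>i. complex_of_real (f i * f i * inverse (f i + \<epsilon>)))"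
            unfolding P(3)[symmetric] Pf Qi_def fun_calc_mult[OF V] by simp
          moreover have "f i * f i * inverse (f i + \<epsilon>) \<le> f i" if "i < d" for i
            using f[OF that] pos[OF that] eps by (simp add: field_simps)
          ultimately show ?thesis
            by (simp add: fun_calc_trace[OF V] trP del: of_real_mult of_real_inverse of_real_add) (rule sum_mono, simp)
        qed
        ultimately show ?thesis by simp
      qed
      finally show ?thesis by simp
    qed
    have "((\<lambda>\<delta>. 2 * Re (mtrace P) + real d * \<epsilon> + \<delta> * c1 + \<delta>\<^sup>2 * c2) \<longlongrightarrow> 2 * Re (mtrace P) + real d * \<epsilon> + 0 * c1 + 0\<^sup>2 * c2) (at_right 0)"
      by (intro tendsto_intros)
    moreover have "eventually (\<lambda>\<delta>. 2 * Re (mtrace X) \<le> 2 * Re (mtrace P) + real d * \<epsilon> + \<delta> * c1 + \<delta>\<^sup>2 * c2) (at_right 0)"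
      using step by (auto simp: eventually_at_right_field intro: exI[of _ 1])
    ultimately have "2 * Re (mtrace X) \<le> 2 * Re (mtrace P) + real d * \<epsilon> + 0 * c1 + 0\<^sup>2 * c2"
      by (intro tendsto_lowerbound) auto
    then show ?thesis by simp
  qed
  have "Re (mtrace X) \<le> Re (mtrace P)"
  proof (rule field_le_epsilon)
    fix e :: real assume "e > 0"
    \<comment> \<open>The denominator \<open>real d + 1\<close> bounds the error by
      \<open>2 * e\<close> and is nonzero also for d = 0.\<close>
    have "2 * Re (mtrace X) \<le> 2 * Re (mtrace P) + real d * (e / (real d + 1))"
      using \<open>e > 0\<close> by (intro main) auto
    also have "real d * (e / (real d + 1)) \<le> 2 * e"
      using \<open>e > 0\<close> by (simp add: field_simps)
    finally show "Re (mtrace X) \<le> Re (mtrace P) + e" by simp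
  qed
  then show ?thesis by (simp add: fidelity_def P_def M_def S_def)
qed

section \<open>Digits and permutations of tensor factors\<close>

abbreviation pinv :: "('a \<Rightarrow> 'a) \<Rightarrow> 'a \<Rightarrow> 'a" where
  "pinv \<pi> \<equiv> inv_into UNIV \<pi>"

text \<open>The inverse of reading off digits. \<open>perm_index\<close> is \<open>encode\<close> of
  permuted digits, so index permutations can be treated digit by digit.\<close>

definition encode :: "nat \<Rightarrow> nat \<Rightarrow> (nat \<Rightarrow> nat) \<Rightarrow> nat" where
  "encode d N j = (\<Sum>l<N. j l * d ^ (N - 1 - l))"

lemma digit_lt: "0 < d \<Longrightarrow> digit d N k x < d"
  by (simp add: digit_def)

text \<open>The first factor is the most significant, so inductions over the number of systems peel
  off the last factor by dividing by \<open>d\<close>.\<close>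

lemma digit_Suc: "l < N \<Longrightarrow> digit d (Suc N) l x = digit d N l (x div d)"
proof -
  assume l: "l < N"
  then have "d ^ (N - l) = d * d ^ (N - 1 - l)"
    by (metis Suc_diff_1 diff_commute power_Suc zero_less_diff)
  then show ?thesis by (simp add: digit_def div_mult2_eq)
qed

lemma digit_last: "digit d (Suc N) N x = x mod d"
  by (simp add: digit_def)

lemma encode_Suc: "encode d (Suc N) j = d * encode d N j + j N"
proof -
  have "(\<Sum>l<N. j l * d ^ (N - l)) = d * encode d N j"
    unfolding encode_def sum_distrib_left
  proof (intro sum.cong refl)
    fix l assume "l \<in> {..<N}"
    then have "d ^ (N - l) = d * d ^ (N - 1 - l)"
      by (metis Suc_diff_1 diff_commute power_Suc zero_less_diff lessThan_iff)
    then show "j l * d ^ (N - l) = d * (j l * d ^ (N - 1 - l))" by simp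
  qed
  then show ?thesis by (simp add: encode_def)
qed

lemma encode_less:
  assumes "\<And>l. l < N \<Longrightarrow> j l < d"
  shows "encode d N j < d ^ N"
  using assms
proof (induction N)
  case 0
  then show ?case by (simp add: encode_def)
next
  case (Suc N)
  then have "encode d N j + 1 \<le> d ^ N" "j N < d" by (simp_all add: Suc_le_eq)
  then have "d * (encode d N j + 1) \<le> d * d ^ N" by (intro mult_le_mono2)
  with \<open>j N < d\<close> show ?case by (simp add: encode_Suc)
qed

lemma digit_encode:
  assumes "\<And>l. l < N \<Longrightarrow> j l < d" "l < N"
  shows "digit d N l (encode d N j) = j l"
  using assms
proof (induction N)
  case (Suc N)
  have jN: "j N < d" using Suc.prems by simp
  show ?case
  proof (cases "l = N")
    case True
    then show ?thesis using jN by (simp add: digit_last encode_Suc)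
  next
    case False
    then have l: "l < N" using Suc.prems by simp
    have "encode d (Suc N) j div d = encode d N j" using jN by (simp add: encode_Suc)
    then show ?thesis using Suc l by (simp add: digit_Suc)
  qed
qed simp

lemma encode_digit: "x < d ^ N \<Longrightarrow> encode d N (\<lambda>l. digit d N l x) = x"
proof (induction N arbitrary: x)
  case 0
  then show ?case by (simp add: encode_def)
next
  case (Suc N)
  have "x div d < d ^ N" using Suc.prems by (metis less_mult_imp_div_less mult.commute power_Suc)
  moreover have "encode d N (\<lambda>l. digit d (Suc N) l x) = encode d N (\<lambda>l. digit d N l (x div d))"
    unfolding encode_def by (intro sum.cong) (auto simp: digit_Suc)
  ultimately show ?case using Suc.IH[of "x div d"] by (simp add: encode_Suc digit_last)
qed

lemma digit_eqI:
  assumes "x < d ^ N" "y < d ^ N" "\<And>l. l < N \<Longrightarrow> digit d N l x = digit d N l y"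
  shows "x = y"
proof -
  have "encode d N (\<lambda>l. digit d N l x) = encode d N (\<lambda>l. digit d N l y)"
    unfolding encode_def using assms(3) by (intro sum.cong) auto
  then show ?thesis using assms(1,2) by (simp add: encode_digit)
qed

text \<open>With system 0 most significant, an index of all \<open>n + 1\<close> systems has the
  form \<open>i * d ^ n + r\<close>, where \<open>i\<close> belongs to the input and
  \<open>r\<close> to the outputs.\<close>

lemma digit_head:
  assumes "i < d" "r < d ^ n"
  shows "digit d (n + 1) 0 (i * d ^ n + r) = i"
proof -
  have "(r + i * d ^ n) div d ^ n = i + r div d ^ n"
    using assms(2) by (intro div_mult_self1) (metis not_less_zero)
  then show ?thesis using assms by (simp add: digit_def add.commute)
qed

lemma digit_tail:
  assumes "0 < d" "l < n" "r < d ^ n"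
  shows "digit d (n + 1) (Suc l) (i * d ^ n + r) = digit d n l r"
proof -
  define D where "D = d ^ (n - Suc l)"
  have "n - Suc l + Suc l = n" using assms(2) by simp
  then have "d ^ n = D * d ^ Suc l"
    unfolding D_def by (metis power_add)
  \<comment> \<open>The place value \<open>D\<close> of the wanted digit divides d ^ n with a
    multiple of \<open>d\<close> as quotient, so the input part disappears modulo
    \<open>d\<close>.\<close>
  then have *: "i * d ^ n + r = r + (i * d ^ l * d) * D" by simp
  have "D \<noteq> 0" using assms(1) by (simp add: D_def)
  then have "(i * d ^ n + r) div D = i * d ^ l * d + r div D"
    unfolding * by (rule div_mult_self1)
  then have "(i * d ^ n + r) div D mod d = r div D mod d"
    by (simp only: mod_mult_self3)
  then show ?thesis by (simp add: digit_def D_def)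
qed

section \<open>Permutations acting on basis indices\<close>

lemma perm_index_encode: "perm_index d N \<pi> x = encode d N (\<lambda>l. digit d N (pinv \<pi> l) x)"
  by (simp add: perm_index_def encode_def)

lemma perm_index_less: "0 < d \<Longrightarrow> perm_index d N \<pi> x < d ^ N"
  unfolding perm_index_encode by (rule encode_less) (rule digit_lt)

lemma digit_perm_index: "0 < d \<Longrightarrow> l < N \<Longrightarrow> digit d N l (perm_index d N \<pi> x) = digit d N (pinv \<pi> l) x"
  unfolding perm_index_encode by (rule digit_encode) (auto simp: digit_lt)

lemma permutes_inv_less:
  assumes "\<pi> permutes {..<N}" "l < N"
  shows "pinv \<pi> l < (N :: nat)"
  using permutes_in_image[OF permutes_inv[OF assms(1)], of l] assms(2) by simp

text \<open>The inverse permutation inside \<open>perm_index\<close> makes this a left action: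
  inverting a composite reverses the order once, and nested digit lookups reverse it again.\<close>

lemma perm_index_comp:
  assumes "0 < d" "\<pi> permutes {..<N}" "\<tau> permutes {..<N}"
  shows "perm_index d N \<pi> (perm_index d N \<tau> x) = perm_index d N (\<pi> \<circ> \<tau>) x"
proof -
  have "pinv (\<pi> \<circ> \<tau>) = pinv \<tau> \<circ> pinv \<pi>"
    using assms by (intro o_inv_distrib permutes_bij)
  then show ?thesis
    unfolding perm_index_encode[of d N \<pi>] perm_index_encode[of d N "\<pi> \<circ> \<tau>"] encode_def
    using assms by (intro sum.cong) (auto simp: digit_perm_index permutes_inv_less)
qed

lemma perm_index_id: "x < d ^ N \<Longrightarrow> perm_index d N id x = x"
  by (simp add: perm_index_encode encode_digit)

lemma perm_index_inv:
  assumes "0 < d" "\<pi> permutes {..<N}" "x < d ^ N"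
  shows "perm_index d N (pinv \<pi>) (perm_index d N \<pi> x) = x" "perm_index d N \<pi> (perm_index d N (pinv \<pi>) x) = x"
  using assms by (simp_all add: perm_index_comp permutes_inv permutes_inv_o perm_index_id)

lemma perm_index_bij:
  assumes "0 < d" "\<pi> permutes {..<N}"
  shows "bij_betw (perm_index d N \<pi>) {..<d ^ N} {..<d ^ N}"
  by (rule bij_betw_byWitness[where f' = "perm_index d N (pinv \<pi>)"])
    (use assms in \<open>auto simp: perm_index_inv perm_index_less\<close>)

text \<open>Bridges the twirl, which ranges over permutations of the outputs, and the facts on
  \<open>perm_index\<close>, which concern all \<open>n + 1\<close> systems.\<close>

lemma permutes_tail: "\<pi> permutes {1..n :: nat} \<Longrightarrow> \<pi> permutes {..<n + 1}"
  by (erule permutes_subset) auto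

section \<open>Symmetrization and partial traces\<close>

text \<open>\<open>Wmat\<close> carries basis index \<open>y\<close> to its
  \<open>perm_index\<close>; an entry of the conjugated matrix is read by going back, hence the
  inverse.\<close>

lemma Wmat_conj:
  assumes d: "0 < d" and \<pi>: "\<pi> permutes {..<N}" and J: "J \<in> carrier_mat (d ^ N) (d ^ N)"
    and rc: "r < d ^ N" "c < d ^ N"
  shows "(Wmat d N \<pi> * J * mat_adjoint (Wmat d N \<pi>)) $$ (r, c) =
    J $$ (perm_index d N (pinv \<pi>) r, perm_index d N (pinv \<pi>) c)"
proof -
  let ?p = "perm_index d N (pinv \<pi>)"
  have W: "Wmat d N \<pi> \<in> carrier_mat (d ^ N) (d ^ N)" by (simp add: Wmat_def)
  have W_index: "Wmat d N \<pi> $$ (x, y) = (if y = ?p x then 1 else 0)" if "x < d ^ N" "y < d ^ N" for x y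
    using that perm_index_inv[OF d \<pi>] by (auto simp: Wmat_def)
  have p: "?p x < d ^ N" for x using d by (rule perm_index_less)
  have WJ: "(Wmat d N \<pi> * J) $$ (r, y) = J $$ (?p r, y)" if y: "y < d ^ N" for y
  proof -
    have "(Wmat d N \<pi> * J) $$ (r, y) = (\<Sum>x<d ^ N. Wmat d N \<pi> $$ (r, x) * J $$ (x, y))"
      using W J rc y by (intro mult_index) auto
    also have "\<dots> = (\<Sum>x<d ^ N. if x = ?p r then J $$ (x, y) else 0)"
      using rc by (intro sum.cong) (auto simp: W_index)
    finally show ?thesis using p by simp
  qed
  have "(Wmat d N \<pi> * J * mat_adjoint (Wmat d N \<pi>)) $$ (r, c) =
      (\<Sum>y<d ^ N. (Wmat d N \<pi> * J) $$ (r, y) * mat_adjoint (Wmat d N \<pi>) $$ (y, c))"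
    using W J rc by (intro mult_index) auto
  also have "\<dots> = (\<Sum>y<d ^ N. if y = ?p c then J $$ (?p r, y) else 0)"
    using rc W by (intro sum.cong) (auto simp: WJ W_index simp del: index_mult_mat(1))
  finally show ?thesis using p by simp
qed

text \<open>The inverses produced by the conjugation vanish when \<open>pinv \<pi>\<close> is
  substituted for \<pi> in the sum over the whole group.\<close>

lemma sym_twirl_index:
  assumes d: "0 < d" and J: "J \<in> carrier_mat (d ^ (n + 1)) (d ^ (n + 1))"
    and rc: "r < d ^ (n + 1)" "c < d ^ (n + 1)"
  shows "sym_twirl d n J $$ (r, c) = (1 / of_nat (fact n)) *
    (\<Sum>\<pi> | \<pi> permutes {1..n}. J $$ (perm_index d (n + 1) \<pi> r, perm_index d (n + 1) \<pi> c))"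
proof -
  have "(\<Sum>\<pi> | \<pi> permutes {1..n}. (Wmat d (n + 1) \<pi> * J * mat_adjoint (Wmat d (n + 1) \<pi>)) $$ (r, c)) =
      (\<Sum>\<pi> | \<pi> permutes {1..n}. J $$ (perm_index d (n + 1) (pinv \<pi>) r, perm_index d (n + 1) (pinv \<pi>) c))"
    by (intro sum.cong refl Wmat_conj[OF d _ J rc]) (auto intro: permutes_tail[simplified])
  also have "\<dots> = (\<Sum>\<pi> | \<pi> permutes {1..n}. J $$ (perm_index d (n + 1) \<pi> r, perm_index d (n + 1) \<pi> c))"
    by (rule sum_permutations_inverse[symmetric])
  finally show ?thesis using rc by (simp add: sym_twirl_def)
qed

lemma sym_twirl_carrier: "sym_twirl d n J \<in> carrier_mat (d ^ (n + 1)) (d ^ (n + 1))"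
  by (simp add: sym_twirl_def)

text \<open>Composing with a fixed \<tau> only relabels the sum over the group, so the twirled
  matrix is invariant under every \<tau>, and a second average is over n! equal terms.\<close>

lemma sym_twirl_idem:
  assumes d: "0 < d" and J: "J \<in> carrier_mat (d ^ (n + 1)) (d ^ (n + 1))"
  shows "sym_twirl d n (sym_twirl d n J) = sym_twirl d n J"
proof (rule eq_matI)
  let ?T = "sym_twirl d n J" and ?p = "perm_index d (n + 1)"
  fix r c assume "r < dim_row ?T" "c < dim_col ?T"
  then have rc: "r < d ^ (n + 1)" "c < d ^ (n + 1)" by (simp_all add: sym_twirl_def)
  have "?T $$ (?p \<tau> r, ?p \<tau> c) = ?T $$ (r, c)" if \<tau>: "\<tau> permutes {1..n}" for \<tau>
  proof -
    have "(\<Sum>\<pi> | \<pi> permutes {1..n}. J $$ (?p \<pi> (?p \<tau> r), ?p \<pi> (?p \<tau> c))) =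
        (\<Sum>\<pi> | \<pi> permutes {1..n}. J $$ (?p (\<pi> \<circ> \<tau>) r, ?p (\<pi> \<circ> \<tau>) c))"
      by (intro sum.cong refl) (use d \<tau> in \<open>auto simp: perm_index_comp permutes_tail[simplified]\<close>)
    also have "\<dots> = (\<Sum>\<pi> | \<pi> permutes {1..n}. J $$ (?p \<pi> r, ?p \<pi> c))"
      by (rule sum_permutations_compose_right[OF \<tau>, symmetric])
    finally show ?thesis
      by (simp only: sym_twirl_index[OF d J perm_index_less[OF d] perm_index_less[OF d]] sym_twirl_index[OF d J rc])
  qed
  then have "(\<Sum>\<tau> | \<tau> permutes {1..n}. ?T $$ (?p \<tau> r, ?p \<tau> c)) = of_nat (fact n) * ?T $$ (r, c)"
    by (simp add: card_permutations[of _ n])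
  then show "sym_twirl d n ?T $$ (r, c) = ?T $$ (r, c)"
    by (subst sym_twirl_index[OF d sym_twirl_carrier rc]) simp
qed (simp_all add: sym_twirl_def)

lemma sym_twirl_psd:
  assumes d: "0 < d" and J: "J \<in> carrier_mat (d ^ (n + 1)) (d ^ (n + 1))" "psd J"
  shows "psd (sym_twirl d n J)"
proof (rule psd_kraus[OF J sym_twirl_carrier])
  \<comment> \<open>The weight enters twice, once conjugated, so its root is taken to obtain 1 /
    n!.\<close>
  let ?p = "perm_index d (n + 1)" and ?s = "complex_of_real (sqrt (1 / fact n))"
  fix r c assume rc: "r < d ^ (n + 1)" "c < d ^ (n + 1)"
  have s: "cnj ?s * ?s = 1 / of_nat (fact n)"
    by (simp flip: of_real_mult)
  have "(\<Sum>x<d ^ (n + 1). \<Sum>y<d ^ (n + 1). cnj (if x = ?p \<pi> r then ?s else 0) * J $$ (x, y) * (if y = ?p \<pi> c then ?s else 0))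
      = (1 / of_nat (fact n)) * J $$ (?p \<pi> r, ?p \<pi> c)" for \<pi>
  proof -
    have "(\<Sum>x<d ^ (n + 1). \<Sum>y<d ^ (n + 1). cnj (if x = ?p \<pi> r then ?s else 0) * J $$ (x, y) * (if y = ?p \<pi> c then ?s else 0))
      = (\<Sum>x<d ^ (n + 1). \<Sum>y<d ^ (n + 1). if y = ?p \<pi> c then (if x = ?p \<pi> r then (cnj ?s * ?s) * J $$ (x, y) else 0) else 0)"
      by (intro sum.cong refl) simp
    also have "\<dots> = (cnj ?s * ?s) * J $$ (?p \<pi> r, ?p \<pi> c)"
      by (simp add: perm_index_less[OF d, of "n + 1", simplified])
    finally show ?thesis unfolding s .
  qed
  then show "sym_twirl d n J $$ (r, c) = (\<Sum>\<pi>\<in>{\<pi>. \<pi> permutes {1..n}}. \<Sum>x<d ^ (n + 1). \<Sum>y<d ^ (n + 1).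
      cnj (if x = ?p \<pi> r then ?s else 0) * J $$ (x, y) * (if y = ?p \<pi> c then ?s else 0))"
    by (simp only: sym_twirl_index[OF d J(1) rc] sum_distrib_left)
qed

section \<open>Partial traces\<close>

definition digits_agree :: "nat \<Rightarrow> nat \<Rightarrow> nat \<Rightarrow> nat \<Rightarrow> nat \<Rightarrow> bool" where
  "digits_agree d N k r c \<longleftrightarrow> (\<forall>l<N. l \<noteq> k \<longrightarrow> digit d N l r = digit d N l c)"

lemma ptr_keep_index:
  assumes "a < d" "b < d"
  shows "ptr_keep d N k M $$ (a, b) = (\<Sum>r<d ^ N. \<Sum>c<d ^ N.
    if digit d N k r = a \<and> digit d N k c = b \<and> digits_agree d N k r c then M $$ (r, c) else 0)"
  using assms by (simp add: ptr_keep_def digits_agree_def)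

lemma ptr_keep_carrier: "ptr_keep d N k M \<in> carrier_mat d d"
  by (simp add: ptr_keep_def)

lemma ptr_keep_psd:
  assumes M: "M \<in> carrier_mat (d ^ N) (d ^ N)" "psd M"
  shows "psd (ptr_keep d N k M)"
proof (rule psd_kraus[OF M ptr_keep_carrier])
  \<comment> \<open>\<open>z r\<close> packs the traced-out digits of \<open>r\<close> into one
    function, with the dummy value 0 elsewhere, so that agreement becomes equality. Each value
    \<kappa> of \<open>z\<close> labels one Kraus operator.\<close>
  define z where "z r = (\<lambda>l. if l < N \<and> l \<noteq> k then digit d N l r else 0)" for r
  have z: "z r = z c \<longleftrightarrow> digits_agree d N k r c" for r c
    by (auto simp: z_def digits_agree_def fun_eq_iff)
  define w where "w \<kappa> a r = (if digit d N k r = a \<and> z r = \<kappa> then 1 else 0 :: complex)" for \<kappa> a r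
  let ?K = "z ` {..<d ^ N}"
  fix a b assume ab: "a < d" "b < d"
  have "(\<Sum>\<kappa>\<in>?K. \<Sum>r<d ^ N. \<Sum>c<d ^ N. cnj (w \<kappa> a r) * M $$ (r, c) * w \<kappa> b c) =
      (\<Sum>r<d ^ N. \<Sum>\<kappa>\<in>?K. \<Sum>c<d ^ N. cnj (w \<kappa> a r) * M $$ (r, c) * w \<kappa> b c)"
    by (rule sum.swap)
  also have "\<dots> = (\<Sum>r<d ^ N. \<Sum>c<d ^ N. \<Sum>\<kappa>\<in>?K. cnj (w \<kappa> a r) * M $$ (r, c) * w \<kappa> b c)"
    by (rule sum.cong[OF refl], rule sum.swap)
  also have "\<dots> = ptr_keep d N k M $$ (a, b)"
    unfolding ptr_keep_index[OF ab]
  proof (intro sum.cong refl)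
    fix r c assume rc: "r \<in> {..<d ^ N}" "c \<in> {..<d ^ N}"
    have "(\<Sum>\<kappa>\<in>?K. cnj (w \<kappa> a r) * M $$ (r, c) * w \<kappa> b c) =
        (\<Sum>\<kappa>\<in>?K. if \<kappa> = z r then (if digit d N k r = a \<and> digit d N k c = b \<and> z c = z r then M $$ (r, c) else 0) else 0)"
      by (intro sum.cong refl) (auto simp: w_def)
    also have "\<dots> = (if digit d N k r = a \<and> digit d N k c = b \<and> z r = z c then M $$ (r, c) else 0)"
      using rc by (auto simp: sum.delta)
    finally show "(\<Sum>\<kappa>\<in>?K. cnj (w \<kappa> a r) * M $$ (r, c) * w \<kappa> b c) =
        (if digit d N k r = a \<and> digit d N k c = b \<and> digits_agree d N k r c then M $$ (r, c) else 0)"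
      unfolding z .
  qed
  finally show "ptr_keep d N k M $$ (a, b) = (\<Sum>\<kappa>\<in>?K. \<Sum>r<d ^ N. \<Sum>c<d ^ N. cnj (w \<kappa> a r) * M $$ (r, c) * w \<kappa> b c)" ..
qed

text \<open>Substitute \<open>perm_index d N \<pi> r\<close> for the summation index: digit
  \<open>k\<close> of \<open>r\<close> is digit \<open>\<pi> k\<close> of the new index, so the kept
  system moves from \<open>k\<close> to \<open>\<pi> k\<close>.\<close>

lemma ptr_keep_permute:
  assumes d: "0 < d" and \<pi>: "\<pi> permutes {..<N}" and k: "k < N" and ab: "a < d" "b < d"
  shows "(\<Sum>r<d ^ N. \<Sum>c<d ^ N. if digit d N k r = a \<and> digit d N k c = b \<and> digits_agree d N k r c
      then M $$ (perm_index d N \<pi> r, perm_index d N \<pi> c) else 0) = ptr_keep d N (\<pi> k) M $$ (a, b)"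
proof -
  let ?p = "perm_index d N \<pi>"
  have \<pi>k: "\<pi> k < N" "pinv \<pi> (\<pi> k) = k"
    using permutes_in_image[OF \<pi>, of k] k permutes_inverses(2)[OF \<pi>] by auto
  have agree: "digits_agree d N (\<pi> k) (?p r) (?p c) \<longleftrightarrow> digits_agree d N k r c" for r c
  proof
    assume L: "digits_agree d N (\<pi> k) (?p r) (?p c)"
    show "digits_agree d N k r c"
      unfolding digits_agree_def
    proof (intro allI impI)
      fix l assume l: "l < N" "l \<noteq> k"
      have "\<pi> l < N" using permutes_in_image[OF \<pi>, of l] l by simp
      moreover have "\<pi> l \<noteq> \<pi> k" using l permutes_inj[OF \<pi>] by (auto dest: injD)
      ultimately have "digit d N (\<pi> l) (?p r) = digit d N (\<pi> l) (?p c)"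
        using L by (simp add: digits_agree_def)
      then show "digit d N l r = digit d N l c"
        using d \<open>\<pi> l < N\<close> by (simp add: digit_perm_index permutes_inverses(2)[OF \<pi>])
    qed
  next
    assume R: "digits_agree d N k r c"
    show "digits_agree d N (\<pi> k) (?p r) (?p c)"
      unfolding digits_agree_def
    proof (intro allI impI)
      fix l assume l: "l < N" "l \<noteq> \<pi> k"
      have "pinv \<pi> l < N" using permutes_inv_less[OF \<pi> l(1)] .
      moreover have "pinv \<pi> l \<noteq> k" using l permutes_inverses(1)[OF \<pi>] by auto
      ultimately show "digit d N l (?p r) = digit d N l (?p c)"
        using R d l by (simp add: digit_perm_index digits_agree_def)
    qed
  qed
  note bij = perm_index_bij[OF d \<pi>]
  let ?g = "\<lambda>r c. if digit d N (\<pi> k) r = a \<and> digit d N (\<pi> k) c = b \<and> digits_agree d N (\<pi> k) r c then M $$ (r, c) else 0"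
  have "ptr_keep d N (\<pi> k) M $$ (a, b) = (\<Sum>r<d ^ N. \<Sum>c<d ^ N. ?g r c)"
    by (rule ptr_keep_index[OF ab])
  also have "\<dots> = (\<Sum>r<d ^ N. \<Sum>c<d ^ N. ?g (?p r) c)"
    by (rule sum.reindex_bij_betw[OF bij, symmetric])
  also have "\<dots> = (\<Sum>r<d ^ N. \<Sum>c<d ^ N. ?g (?p r) (?p c))"
    by (rule sum.cong[OF refl], rule sum.reindex_bij_betw[OF bij, symmetric])
  finally show ?thesis
    using d \<pi>k by (simp add: digit_perm_index agree)
qed

lemma ptr_keep_sym_twirl:
  assumes d: "0 < d" and M: "M \<in> carrier_mat (d ^ (n + 1)) (d ^ (n + 1))" and k: "k < n + 1" and ab: "a < d" "b < d"
  shows "ptr_keep d (n + 1) k (sym_twirl d n M) $$ (a, b) =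
    (1 / of_nat (fact n)) * (\<Sum>\<pi> | \<pi> permutes {1..n}. ptr_keep d (n + 1) (\<pi> k) M $$ (a, b))"
proof -
  let ?N = "n + 1" and ?P = "{\<pi>. \<pi> permutes {1..n}}"
  define C where "C r c \<longleftrightarrow> digit d ?N k r = a \<and> digit d ?N k c = b \<and> digits_agree d ?N k r c" for r c
  let ?g = "\<lambda>\<pi> r c. if C r c then M $$ (perm_index d ?N \<pi> r, perm_index d ?N \<pi> c) else 0"
  have "ptr_keep d ?N k (sym_twirl d n M) $$ (a, b) = (\<Sum>r<d ^ ?N. \<Sum>c<d ^ ?N. if C r c then sym_twirl d n M $$ (r, c) else 0)"
    unfolding C_def by (rule ptr_keep_index[OF ab])
  also have "\<dots> = (\<Sum>r<d ^ ?N. \<Sum>c<d ^ ?N. (1 / of_nat (fact n)) * (\<Sum>\<pi>\<in>?P. ?g \<pi> r c))"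
    by (intro sum.cong refl) (auto simp: sym_twirl_index[OF d M, simplified])
  also have "\<dots> = (1 / of_nat (fact n)) * (\<Sum>r<d ^ ?N. \<Sum>c<d ^ ?N. \<Sum>\<pi>\<in>?P. ?g \<pi> r c)"
    by (simp only: sum_distrib_left)
  also have "(\<Sum>r<d ^ ?N. \<Sum>c<d ^ ?N. \<Sum>\<pi>\<in>?P. ?g \<pi> r c) = (\<Sum>r<d ^ ?N. \<Sum>\<pi>\<in>?P. \<Sum>c<d ^ ?N. ?g \<pi> r c)"
    by (rule sum.cong[OF refl], rule sum.swap)
  also have "\<dots> = (\<Sum>\<pi>\<in>?P. \<Sum>r<d ^ ?N. \<Sum>c<d ^ ?N. ?g \<pi> r c)"
    by (rule sum.swap)
  also have "\<dots> = (\<Sum>\<pi>\<in>?P. ptr_keep d ?N (\<pi> k) M $$ (a, b))"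
    unfolding C_def by (intro sum.cong refl ptr_keep_permute[OF d _ k ab]) (auto intro: permutes_tail[simplified])
  finally show ?thesis .
qed

text \<open>The permutations in the twirl fix system 0, so all n! terms coincide.\<close>

lemma ptr_keep_input_sym_twirl:
  assumes d: "0 < d" and M: "M \<in> carrier_mat (d ^ (n + 1)) (d ^ (n + 1))"
  shows "ptr_keep d (n + 1) 0 (sym_twirl d n M) = ptr_keep d (n + 1) 0 M"
proof (rule eq_matI)
  fix a b assume "a < dim_row (ptr_keep d (n + 1) 0 M)" "b < dim_col (ptr_keep d (n + 1) 0 M)"
  then have ab: "a < d" "b < d" by (simp_all add: ptr_keep_def)
  have "(\<Sum>\<pi> | \<pi> permutes {1..n}. ptr_keep d (n + 1) (\<pi> 0) M $$ (a, b)) =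
      (\<Sum>\<pi> | \<pi> permutes {1..n}. ptr_keep d (n + 1) 0 M $$ (a, b))"
    by (intro sum.cong refl) (auto dest: permutes_not_in[where x = 0])
  then show "ptr_keep d (n + 1) 0 (sym_twirl d n M) $$ (a, b) = ptr_keep d (n + 1) 0 M $$ (a, b)"
    by (subst ptr_keep_sym_twirl[OF d M _ ab], simp, simp only:) (simp add: card_permutations[of _ n])
qed (simp_all add: ptr_keep_def)

text \<open>The left-hand side does not depend on \<open>k\<close>, so it can be averaged over \<open>k\<close>, which
  avoids counting the permutations with a prescribed value.\<close>
lemma ptr_keep_output_sym_twirl:
  assumes d: "0 < d" and M: "M \<in> carrier_mat (d ^ (n + 1)) (d ^ (n + 1))" and k: "k \<in> {1..n}" and ab: "a < d" "b < d"
  shows "ptr_keep d (n + 1) k (sym_twirl d n M) $$ (a, b) =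
    (1 / of_nat n) * (\<Sum>j\<in>{1..n}. ptr_keep d (n + 1) j M $$ (a, b))"
proof -
  let ?P = "{\<pi>. \<pi> permutes {1..n}}" and ?h = "\<lambda>j. ptr_keep d (n + 1) j M $$ (a, b)"
  have indep: "(\<Sum>\<pi>\<in>?P. ?h (\<pi> j)) = (\<Sum>\<pi>\<in>?P. ?h (\<pi> k))" if j: "j \<in> {1..n}" for j
  proof -
    \<comment> \<open>Composition on the right with this transposition turns \<open>\<pi> k\<close>
      into \<open>\<pi> j\<close> and maps the set of permutations onto itself.\<close>
    have t: "Transposition.transpose k j permutes {1..n}"
      using k j by (intro permutes_swap_id)
    show ?thesis
      using sum_permutations_compose_right[OF t, of "\<lambda>\<pi>. ?h (\<pi> k)"] by simp
  qed
  have "of_nat n * (\<Sum>\<pi>\<in>?P. ?h (\<pi> k)) = (\<Sum>j\<in>{1..n}. \<Sum>\<pi>\<in>?P. ?h (\<pi> j))"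
    by (subst sum.cong[OF refl indep]) simp_all
  also have "\<dots> = (\<Sum>\<pi>\<in>?P. \<Sum>j\<in>{1..n}. ?h (\<pi> j))"
    by (rule sum.swap)
  also have "\<dots> = (\<Sum>\<pi>\<in>?P. \<Sum>j\<in>{1..n}. ?h j)"
  proof (rule sum.cong[OF refl])
    fix \<pi> assume "\<pi> \<in> ?P"
    then have "\<pi> permutes {1..n}" by simp
    from sum.permute[OF this, of ?h] show "(\<Sum>j\<in>{1..n}. ?h (\<pi> j)) = (\<Sum>j\<in>{1..n}. ?h j)"
      by (simp only: o_def)
  qed
  also have "\<dots> = of_nat (fact n) * (\<Sum>j\<in>{1..n}. ?h j)"
    by (simp add: card_permutations[of _ n])
  finally have "of_nat n * (\<Sum>\<pi>\<in>?P. ?h (\<pi> k)) = of_nat (fact n) * (\<Sum>j\<in>{1..n}. ?h j)" .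
  moreover have "of_nat n \<noteq> (0 :: complex)" using k by simp
  ultimately have "(1 / of_nat (fact n)) * (\<Sum>\<pi>\<in>?P. ?h (\<pi> k)) = (1 / of_nat n) * (\<Sum>j\<in>{1..n}. ?h j)"
    by (simp add: field_simps)
  then show ?thesis
    using k by (subst ptr_keep_sym_twirl[OF d M _ ab]) auto
qed

section \<open>Channels and Choi matrices\<close>

lemma sum_lessThan_mult:
  fixes f :: "nat \<Rightarrow> 'a :: comm_monoid_add"
  shows "(\<Sum>x<a * b. f x) = (\<Sum>i<a. \<Sum>r<b. f (i * b + r))"
proof -
  have "sum f {m * b..<m * b + b} = (\<Sum>r<b. f (m * b + r))" for m
    by (rule sum.reindex_bij_witness[where i = "\<lambda>r. m * b + r" and j = "\<lambda>x. x - m * b"]) auto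
  then show ?thesis by (simp flip: sum.nat_group)
qed

lemma index_less_mult:
  assumes "i < a" "r < b"
  shows "i * b + r < a * (b :: nat)"
proof -
  have "i * b + r < Suc i * b" using assms by simp
  also have "\<dots> \<le> a * b" using assms by (intro mult_le_mono1) simp
  finally show ?thesis .
qed

text \<open>This is J (A^T \<otimes> 1) with the input traced out: block (i, k) of \<open>J\<close>
  is weighted by entry (i, k) of \<open>A\<close>, the transpose undoing the index reversal of the
  trace.\<close>

definition apply_choi :: "nat \<Rightarrow> nat \<Rightarrow> complex mat \<Rightarrow> complex mat \<Rightarrow> complex mat" where
  "apply_choi d D J A = mat D D (\<lambda>(r, c). \<Sum>i<d. \<Sum>k<d. A $$ (i, k) * J $$ (i * D + r, k * D + c))"

lemma apply_choi_carrier: "apply_choi d D J A \<in> carrier_mat D D"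
  by (simp add: apply_choi_def)

section \<open>Multiplication by an operator on the input\<close>

lemma kron_one_index:
  assumes A: "A \<in> carrier_mat d d" and "x < d * D" "y < d * D"
  shows "kron (transpose_mat A) (1\<^sub>m D) $$ (x, y) = (if x mod D = y mod D then A $$ (y div D, x div D) else 0)"
proof -
  have "x div D < d" "y div D < d" "x mod D < D" "y mod D < D"
    using assms(2,3) by (auto simp: less_mult_imp_div_less intro!: mod_less_divisor gr0I)
  then show ?thesis using assms by (simp add: kron_def)
qed

lemma kron_one_carrier: "A \<in> carrier_mat d d \<Longrightarrow> kron (transpose_mat A) (1\<^sub>m (d ^ n)) \<in> carrier_mat (d ^ (n + 1)) (d ^ (n + 1))"
  by (auto simp: kron_def)

text \<open>Only the input digit of the column index is summed over; the output part
  \<open>C mod d ^ n\<close> is carried along unchanged. This is the form to which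
  \<open>perm_index_tail\<close> applies.\<close>

lemma input_index:
  assumes d: "0 < d" and A: "A \<in> carrier_mat d d" and J: "J \<in> carrier_mat (d ^ (n + 1)) (d ^ (n + 1))"
    and RC: "R < d ^ (n + 1)" "C < d ^ (n + 1)"
  shows "(J * kron (transpose_mat A) (1\<^sub>m (d ^ n))) $$ (R, C) =
    (\<Sum>k<d. J $$ (R, k * d ^ n + C mod d ^ n) * A $$ (C div d ^ n, k))"
proof -
  let ?D = "d ^ n"
  have Cm: "C mod ?D < ?D" using d by simp
  have "(J * kron (transpose_mat A) (1\<^sub>m ?D)) $$ (R, C) =
      (\<Sum>x<d ^ (n + 1). J $$ (R, x) * kron (transpose_mat A) (1\<^sub>m ?D) $$ (x, C))"
    using J kron_one_carrier[OF A] RC by (intro mult_index) auto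
  also have "\<dots> = (\<Sum>x<d * ?D. J $$ (R, x) * kron (transpose_mat A) (1\<^sub>m ?D) $$ (x, C))"
    by simp
  also have "\<dots> = (\<Sum>k<d. \<Sum>s<?D. J $$ (R, k * ?D + s) * kron (transpose_mat A) (1\<^sub>m ?D) $$ (k * ?D + s, C))"
    by (rule sum_lessThan_mult)
  also have "\<dots> = (\<Sum>k<d. \<Sum>s<?D. if s = C mod ?D then J $$ (R, k * ?D + s) * A $$ (C div ?D, k) else 0)"
  proof (intro sum.cong refl)
    fix k s assume "k \<in> {..<d}" "s \<in> {..<?D}"
    then have *: "k * ?D + s < d * ?D" "(k * ?D + s) mod ?D = s" "(k * ?D + s) div ?D = k"
      by (auto intro: index_less_mult)
    have "C < d * ?D" using RC by simp
    then show "J $$ (R, k * ?D + s) * kron (transpose_mat A) (1\<^sub>m ?D) $$ (k * ?D + s, C) =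
        (if s = C mod ?D then J $$ (R, k * ?D + s) * A $$ (C div ?D, k) else 0)"
      unfolding kron_one_index[OF A *(1) \<open>C < d * ?D\<close>] *(2,3) by (auto simp only: mult_zero_right split: if_splits)
  qed
  finally show ?thesis using Cm by simp
qed

lemma split_index:
  fixes d x :: nat
  assumes "0 < d" "x < d ^ (n + 1)"
  shows "x div d ^ n < d" "x mod d ^ n < d ^ n" "x = (x div d ^ n) * d ^ n + x mod d ^ n"
proof -
  have "x < d * d ^ n" using assms(2) by simp
  then show "x div d ^ n < d" by (rule less_mult_imp_div_less)
  show "x mod d ^ n < d ^ n" using assms(1) by simp
  show "x = (x div d ^ n) * d ^ n + x mod d ^ n" by (rule div_mult_mod_eq[symmetric])
qed

lemma digit_0_div: "0 < d \<Longrightarrow> x < d ^ (n + 1) \<Longrightarrow> digit d (n + 1) 0 x = x div d ^ n"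
  using digit_head[of "x div d ^ n" d "x mod d ^ n" n] split_index[of d x n] by metis

lemma digit_Suc_mod: "0 < d \<Longrightarrow> x < d ^ (n + 1) \<Longrightarrow> l < n \<Longrightarrow> digit d (n + 1) (Suc l) x = digit d n l (x mod d ^ n)"
  using digit_tail[of d l n "x mod d ^ n" "x div d ^ n"] split_index[of d x n] by metis

lemma perm_index_head:
  assumes d: "0 < d" and \<pi>: "\<pi> permutes {1..n}" and C: "C < d ^ (n + 1)"
  shows "perm_index d (n + 1) \<pi> C div d ^ n = C div d ^ n"
proof -
  have "pinv \<pi> 0 = 0" using permutes_not_in[OF permutes_inv[OF \<pi>], of 0] by simp
  then have "digit d (n + 1) 0 (perm_index d (n + 1) \<pi> C) = digit d (n + 1) 0 C"
    using d by (simp add: digit_perm_index)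
  then show ?thesis using d C perm_index_less[OF d] by (simp only: digit_0_div)
qed

text \<open>Permuting the outputs commutes with overwriting the input digit by \<open>k\<close>:
  position 0 is fixed by \<pi>, and the other positions are permuted among themselves.\<close>

lemma perm_index_tail:
  assumes d: "0 < d" and \<pi>: "\<pi> permutes {1..n}" and C: "C < d ^ (n + 1)" and k: "k < d"
  shows "perm_index d (n + 1) \<pi> (k * d ^ n + C mod d ^ n) = k * d ^ n + perm_index d (n + 1) \<pi> C mod d ^ n"
proof (rule digit_eqI)
  let ?p = "perm_index d (n + 1) \<pi>"
  have Cm: "C mod d ^ n < d ^ n" "?p C mod d ^ n < d ^ n" using d by simp_all
  show "?p (k * d ^ n + C mod d ^ n) < d ^ (n + 1)" using d by (rule perm_index_less)
  show "k * d ^ n + ?p C mod d ^ n < d ^ (n + 1)" using index_less_mult[OF k Cm(2)] by simp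
  fix l assume l: "l < n + 1"
  show "digit d (n + 1) l (?p (k * d ^ n + C mod d ^ n)) = digit d (n + 1) l (k * d ^ n + ?p C mod d ^ n)"
  proof (cases l)
    case 0
    have "pinv \<pi> 0 = 0" using permutes_not_in[OF permutes_inv[OF \<pi>], of 0] by simp
    then have "digit d (n + 1) 0 (?p (k * d ^ n + C mod d ^ n)) = digit d (n + 1) 0 (k * d ^ n + C mod d ^ n)"
      using d by (simp add: digit_perm_index)
    then show ?thesis unfolding 0 using digit_head[OF k Cm(1)] digit_head[OF k Cm(2)] by (simp only:)
  next
    case (Suc l')
    then have l': "l' < n" "l \<in> {1..n}" using l by auto
    have "pinv \<pi> l \<in> {1..n}" using permutes_in_image[OF permutes_inv[OF \<pi>], of l] l'(2) by simp
    then obtain l'' where l'': "pinv \<pi> l = Suc l''" "l'' < n" by (cases "pinv \<pi> l") auto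
    have "digit d (n + 1) l (?p (k * d ^ n + C mod d ^ n)) = digit d (n + 1) (Suc l'') (k * d ^ n + C mod d ^ n)"
      using digit_perm_index[OF d l, of \<pi>] l''(1) by simp
    also have "\<dots> = digit d n l'' (C mod d ^ n)"
      by (rule digit_tail[OF d l''(2) Cm(1)])
    also have "\<dots> = digit d (n + 1) (pinv \<pi> l) C"
      unfolding l''(1) by (rule digit_Suc_mod[OF d C l''(2), symmetric])
    also have "\<dots> = digit d (n + 1) l (?p C)"
      by (rule digit_perm_index[OF d l, symmetric])
    also have "\<dots> = digit d n l' (?p C mod d ^ n)"
      unfolding Suc by (rule digit_Suc_mod[OF d perm_index_less[OF d] l'(1)])
    also have "\<dots> = digit d (n + 1) l (k * d ^ n + ?p C mod d ^ n)"
      unfolding Suc by (rule digit_tail[OF d l'(1) Cm(2), symmetric])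
    finally show ?thesis .
  qed
qed

text \<open>The permutation operators act on the outputs and A^T \<otimes> 1 on the input, so they
  commute. Facts on partial traces of twirled matrices thereby apply to J (A^T \<otimes> 1), whose
  output marginals are those of the channel.\<close>

lemma input_sym_twirl:
  assumes d: "0 < d" and A: "A \<in> carrier_mat d d" and J: "J \<in> carrier_mat (d ^ (n + 1)) (d ^ (n + 1))"
  shows "sym_twirl d n J * kron (transpose_mat A) (1\<^sub>m (d ^ n)) = sym_twirl d n (J * kron (transpose_mat A) (1\<^sub>m (d ^ n)))"
proof -
  let ?K = "kron (transpose_mat A) (1\<^sub>m (d ^ n))" and ?N = "n + 1"
  have K: "?K \<in> carrier_mat (d ^ ?N) (d ^ ?N)" using A by (rule kron_one_carrier)
  have JK: "J * ?K \<in> carrier_mat (d ^ ?N) (d ^ ?N)" using J K by (rule mult_carrier_mat)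
  have TK: "sym_twirl d n J * ?K \<in> carrier_mat (d ^ ?N) (d ^ ?N)" using sym_twirl_carrier K by (rule mult_carrier_mat)
  show ?thesis
  proof (rule eq_matI)
    fix R C assume "R < dim_row (sym_twirl d n (J * ?K))" "C < dim_col (sym_twirl d n (J * ?K))"
    then have RC: "R < d ^ ?N" "C < d ^ ?N" by (simp_all add: sym_twirl_def)
    have "(sym_twirl d n J * ?K) $$ (R, C) = (\<Sum>k<d. sym_twirl d n J $$ (R, k * d ^ n + C mod d ^ n) * A $$ (C div d ^ n, k))"
      by (rule input_index[OF d A sym_twirl_carrier RC])
    also have "\<dots> = (\<Sum>k<d. \<Sum>\<pi> | \<pi> permutes {1..n}. (1 / of_nat (fact n)) *
        (J $$ (perm_index d ?N \<pi> R, k * d ^ n + perm_index d ?N \<pi> C mod d ^ n) * A $$ (perm_index d ?N \<pi> C div d ^ n, k)))"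
    proof (rule sum.cong[OF refl])
      fix k assume "k \<in> {..<d}"
      then have k: "k < d" by simp
      then have kC: "k * d ^ n + C mod d ^ n < d ^ ?N"
        using d index_less_mult[of k d "C mod d ^ n" "d ^ n"] by simp
      have "sym_twirl d n J $$ (R, k * d ^ n + C mod d ^ n) * A $$ (C div d ^ n, k) =
          (\<Sum>\<pi> | \<pi> permutes {1..n}. (1 / of_nat (fact n)) *
          (J $$ (perm_index d ?N \<pi> R, perm_index d ?N \<pi> (k * d ^ n + C mod d ^ n)) * A $$ (C div d ^ n, k)))"
        by (simp only: sym_twirl_index[OF d J RC(1) kC] sum_distrib_left sum_distrib_right mult.assoc)
      also have "\<dots> = (\<Sum>\<pi> | \<pi> permutes {1..n}. (1 / of_nat (fact n)) *
          (J $$ (perm_index d ?N \<pi> R, k * d ^ n + perm_index d ?N \<pi> C mod d ^ n) * A $$ (perm_index d ?N \<pi> C div d ^ n, k)))"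
        by (rule sum.cong[OF refl]) (simp only: mem_Collect_eq perm_index_head[OF d _ RC(2)] perm_index_tail[OF d _ RC(2) k])
      finally show "sym_twirl d n J $$ (R, k * d ^ n + C mod d ^ n) * A $$ (C div d ^ n, k) = \<dots>" .
    qed
    also have "\<dots> = (\<Sum>\<pi> | \<pi> permutes {1..n}. \<Sum>k<d. (1 / of_nat (fact n)) *
        (J $$ (perm_index d ?N \<pi> R, k * d ^ n + perm_index d ?N \<pi> C mod d ^ n) * A $$ (perm_index d ?N \<pi> C div d ^ n, k)))"
      by (rule sum.swap)
    also have "\<dots> = (1 / of_nat (fact n)) * (\<Sum>\<pi> | \<pi> permutes {1..n}. \<Sum>k<d.
        J $$ (perm_index d ?N \<pi> R, k * d ^ n + perm_index d ?N \<pi> C mod d ^ n) * A $$ (perm_index d ?N \<pi> C div d ^ n, k))"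
      by (simp only: sum_distrib_left)
    also have "\<dots> = (1 / of_nat (fact n)) * (\<Sum>\<pi> | \<pi> permutes {1..n}. (J * ?K) $$ (perm_index d ?N \<pi> R, perm_index d ?N \<pi> C))"
      by (simp only: input_index[OF d A J perm_index_less[OF d] perm_index_less[OF d]])
    also have "\<dots> = sym_twirl d n (J * ?K) $$ (R, C)"
      by (rule sym_twirl_index[OF d JK RC, symmetric])
    finally show "(sym_twirl d n J * ?K) $$ (R, C) = sym_twirl d n (J * ?K) $$ (R, C)" .
  qed (simp_all only: carrier_matD[OF TK] carrier_matD[OF sym_twirl_carrier])
qed

section \<open>Marginals of the Choi matrix and of the output state\<close>

lemma digits_agree_input:
  assumes d: "0 < d" and x: "i < d" "k < d" "r < d ^ n" "c < d ^ n"
  shows "digits_agree d (n + 1) 0 (i * d ^ n + r) (k * d ^ n + c) \<longleftrightarrow> r = c"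
proof
  assume L: "digits_agree d (n + 1) 0 (i * d ^ n + r) (k * d ^ n + c)"
  show "r = c"
  proof (rule digit_eqI[OF x(3,4)])
    fix l assume l: "l < n"
    then have "digit d (n + 1) (Suc l) (i * d ^ n + r) = digit d (n + 1) (Suc l) (k * d ^ n + c)"
      using L by (simp add: digits_agree_def)
    then show "digit d n l r = digit d n l c"
      by (simp only: digit_tail[OF d l x(3)] digit_tail[OF d l x(4)])
  qed
next
  assume "r = c"
  then show "digits_agree d (n + 1) 0 (i * d ^ n + r) (k * d ^ n + c)"
    unfolding digits_agree_def
  proof (intro allI impI)
    fix l assume "l < n + 1" "l \<noteq> 0"
    then obtain l' where l': "l = Suc l'" "l' < n" by (cases l) auto
    show "digit d (n + 1) l (i * d ^ n + r) = digit d (n + 1) l (k * d ^ n + c)"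
      unfolding l'(1) digit_tail[OF d l'(2) x(3)] digit_tail[OF d l'(2) x(4)] using \<open>r = c\<close> by simp
  qed
qed

text \<open>Keeping an output means tracing out the input, which forces the input digits to agree;
  what remains is the condition for the \<open>n\<close> outputs alone. Output \<open>j\<close> sits
  at position \<open>Suc j\<close> because the input occupies position 0.\<close>

lemma digits_agree_output:
  assumes d: "0 < d" and x: "i < d" "k < d" "r < d ^ n" "c < d ^ n" and j: "j < n"
  shows "digits_agree d (n + 1) (Suc j) (i * d ^ n + r) (k * d ^ n + c) \<longleftrightarrow> i = k \<and> digits_agree d n j r c"
proof (intro iffI conjI)
  assume L: "digits_agree d (n + 1) (Suc j) (i * d ^ n + r) (k * d ^ n + c)"
  then have "digit d (n + 1) 0 (i * d ^ n + r) = digit d (n + 1) 0 (k * d ^ n + c)"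
    by (simp add: digits_agree_def)
  then show "i = k" by (simp only: digit_head[OF x(1,3)] digit_head[OF x(2,4)])
  show "digits_agree d n j r c"
    unfolding digits_agree_def
  proof (intro allI impI)
    fix l assume l: "l < n" "l \<noteq> j"
    then have "digit d (n + 1) (Suc l) (i * d ^ n + r) = digit d (n + 1) (Suc l) (k * d ^ n + c)"
      using L by (simp add: digits_agree_def)
    then show "digit d n l r = digit d n l c"
      by (simp only: digit_tail[OF d l(1) x(3)] digit_tail[OF d l(1) x(4)])
  qed
next
  assume R: "i = k \<and> digits_agree d n j r c"
  show "digits_agree d (n + 1) (Suc j) (i * d ^ n + r) (k * d ^ n + c)"
    unfolding digits_agree_def
  proof (intro allI impI)
    fix l assume l: "l < n + 1" "l \<noteq> Suc j"
    show "digit d (n + 1) l (i * d ^ n + r) = digit d (n + 1) l (k * d ^ n + c)"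
    proof (cases l)
      case 0
      show ?thesis unfolding 0 digit_head[OF x(1,3)] digit_head[OF x(2,4)] using R by simp
    next
      case (Suc l')
      then have l': "l' < n" "l' \<noteq> j" using l by auto
      show ?thesis unfolding Suc digit_tail[OF d l'(1) x(3)] digit_tail[OF d l'(1) x(4)]
        using R l' by (simp add: digits_agree_def)
    qed
  qed
qed

lemma sum_pairs_split:
  fixes f :: "nat \<Rightarrow> nat \<Rightarrow> 'a :: comm_monoid_add"
  shows "(\<Sum>x<d ^ (n + 1). \<Sum>y<d ^ (n + 1). f x y) =
    (\<Sum>i<d. \<Sum>r<d ^ n. \<Sum>k<d. \<Sum>c<d ^ n. f (i * d ^ n + r) (k * d ^ n + c))"
  by (simp add: sum_lessThan_mult)

lemma ptr_keep_input:
  assumes d: "0 < d" and ab: "a < d" "b < d"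
  shows "ptr_keep d (n + 1) 0 J $$ (a, b) = (\<Sum>r<d ^ n. J $$ (a * d ^ n + r, b * d ^ n + r))"
proof -
  have "ptr_keep d (n + 1) 0 J $$ (a, b) = (\<Sum>i<d. \<Sum>r<d ^ n. \<Sum>k<d. \<Sum>c<d ^ n.
      if digit d (n + 1) 0 (i * d ^ n + r) = a \<and> digit d (n + 1) 0 (k * d ^ n + c) = b \<and>
        digits_agree d (n + 1) 0 (i * d ^ n + r) (k * d ^ n + c) then J $$ (i * d ^ n + r, k * d ^ n + c) else 0)"
    unfolding ptr_keep_index[OF ab] by (rule sum_pairs_split)
  also have "\<dots> = (\<Sum>i<d. \<Sum>r<d ^ n. \<Sum>k<d. \<Sum>c<d ^ n.
      if c = r then if k = b then if i = a then J $$ (i * d ^ n + r, k * d ^ n + c) else 0 else 0 else 0)"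
    by (intro sum.cong refl) (simp only: lessThan_iff digit_head digits_agree_input[OF d], auto)
  also have "\<dots> = (\<Sum>i<d. \<Sum>r<d ^ n. if i = a then J $$ (i * d ^ n + r, b * d ^ n + r) else 0)"
    using ab by (simp add: sum.delta)
  also have "\<dots> = (\<Sum>i<d. if i = a then (\<Sum>r<d ^ n. J $$ (i * d ^ n + r, b * d ^ n + r)) else 0)"
    by (intro sum.cong refl) auto
  finally show ?thesis using ab by simp
qed

text \<open>Tracing out everything but one output can be done in two stages: the input first, which
  gives the contraction in \<open>apply_choi\<close>, then the other outputs.\<close>

lemma ptr_keep_output:
  assumes d: "0 < d" and A: "A \<in> carrier_mat d d" and J: "J \<in> carrier_mat (d ^ (n + 1)) (d ^ (n + 1))" and j: "j < n"
  shows "ptr_keep d (n + 1) (Suc j) (J * kron (transpose_mat A) (1\<^sub>m (d ^ n))) = ptr_keep d n j (apply_choi d (d ^ n) J A)"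
proof (rule eq_matI)
  let ?L = "J * kron (transpose_mat A) (1\<^sub>m (d ^ n))" and ?D = "d ^ n"
  fix a b assume "a < dim_row (ptr_keep d n j (apply_choi d ?D J A))" "b < dim_col (ptr_keep d n j (apply_choi d ?D J A))"
  then have ab: "a < d" "b < d" by (simp_all add: ptr_keep_def)
  define Q where "Q r c \<longleftrightarrow> digit d n j r = a \<and> digit d n j c = b \<and> digits_agree d n j r c" for r c
  have L: "?L $$ (i * ?D + r, k * ?D + c) = (\<Sum>l<d. A $$ (k, l) * J $$ (i * ?D + r, l * ?D + c))"
    if "i < d" "k < d" "r < ?D" "c < ?D" for i k r c
  proof -
    have "i * ?D + r < d ^ (n + 1)" "k * ?D + c < d ^ (n + 1)" "(k * ?D + c) mod ?D = c" "(k * ?D + c) div ?D = k"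
      using index_less_mult[of i d r ?D] index_less_mult[of k d c ?D] that by auto
    then show ?thesis by (simp only: input_index[OF d A J] mult.commute)
  qed
  have "ptr_keep d (n + 1) (Suc j) ?L $$ (a, b) = (\<Sum>i<d. \<Sum>r<?D. \<Sum>k<d. \<Sum>c<?D.
      if digit d (n + 1) (Suc j) (i * ?D + r) = a \<and> digit d (n + 1) (Suc j) (k * ?D + c) = b \<and>
        digits_agree d (n + 1) (Suc j) (i * ?D + r) (k * ?D + c) then ?L $$ (i * ?D + r, k * ?D + c) else 0)"
    unfolding ptr_keep_index[OF ab] by (rule sum_pairs_split)
  also have "\<dots> = (\<Sum>i<d. \<Sum>r<?D. \<Sum>k<d. \<Sum>c<?D. if k = i then
      if Q r c then (\<Sum>l<d. A $$ (k, l) * J $$ (i * ?D + r, l * ?D + c)) else 0 else 0)"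
    by (intro sum.cong refl) (simp only: lessThan_iff digit_tail[OF d j] digits_agree_output[OF d _ _ _ _ j] L Q_def, auto)
  also have "\<dots> = (\<Sum>i<d. \<Sum>r<?D. \<Sum>c<?D. \<Sum>k<d. if k = i then
      if Q r c then (\<Sum>l<d. A $$ (k, l) * J $$ (i * ?D + r, l * ?D + c)) else 0 else 0)"
    by (rule sum.cong[OF refl], rule sum.cong[OF refl], rule sum.swap)
  also have "\<dots> = (\<Sum>i<d. \<Sum>r<?D. \<Sum>c<?D.
      if Q r c then (\<Sum>l<d. A $$ (i, l) * J $$ (i * ?D + r, l * ?D + c)) else 0)"
    by (intro sum.cong refl) simp
  also have "\<dots> = (\<Sum>r<?D. \<Sum>i<d. \<Sum>c<?D.
      if Q r c then (\<Sum>l<d. A $$ (i, l) * J $$ (i * ?D + r, l * ?D + c)) else 0)"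
    by (rule sum.swap)
  also have "\<dots> = (\<Sum>r<?D. \<Sum>c<?D. \<Sum>i<d.
      if Q r c then (\<Sum>l<d. A $$ (i, l) * J $$ (i * ?D + r, l * ?D + c)) else 0)"
    by (rule sum.cong[OF refl], rule sum.swap)
  also have "\<dots> = (\<Sum>r<?D. \<Sum>c<?D. if Q r c then apply_choi d ?D J A $$ (r, c) else 0)"
    by (intro sum.cong refl) (auto simp: apply_choi_def)
  also have "\<dots> = ptr_keep d n j (apply_choi d ?D J A) $$ (a, b)"
    unfolding ptr_keep_index[OF ab] Q_def ..
  finally show "ptr_keep d (n + 1) (Suc j) ?L $$ (a, b) = ptr_keep d n j (apply_choi d ?D J A) $$ (a, b)" .
qed (simp_all add: ptr_keep_def)

text \<open>With \<open>J\<close> written as \<open>C\<close> times its adjoint, every column of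
  \<open>C\<close>, reshaped to a matrix between input and output, is a Kraus operator of the map,
  and \<open>psd_kraus\<close> applies.\<close>

lemma psd_ext_map_apply_choi:
  assumes d: "0 < d" and D: "0 < D" and J: "J \<in> carrier_mat (d * D) (d * D)" "psd J"
    and M: "M \<in> carrier_mat (k * d) (k * d)" "psd M"
  shows "psd (ext_map k d D (apply_choi d D J) M)"
proof -
  obtain C where C: "C \<in> carrier_mat (d * D) (d * D)" "psd C" "C * C = J" using psd_factor[OF J] .
  have J_index: "J $$ (x, y) = (\<Sum>l<d * D. C $$ (x, l) * cnj (C $$ (y, l)))" if "x < d * D" "y < d * D" for x y
  proof -
    have "cnj (C $$ (y, l)) = C $$ (l, y)" if "l < d * D" for l
      using adj_index[of l C y] C(1) psd_hermitian[OF C(2)] that \<open>y < d * D\<close> by simp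
    then show ?thesis
      using mult_index[OF C(1) C(1) that] C(3) by simp
  qed
  \<comment> \<open>\<open>x div D\<close> and \<open>y div d\<close> are the ancilla indices, on
    which the operator acts as the identity. The conjugation is undone on the left, where
    \<open>psd_kraus\<close> conjugates the weight.\<close>
  define w where "w l x y = (if y div d = x div D then cnj (C $$ ((y mod d) * D + x mod D, l)) else 0)" for l x y
  show ?thesis
  proof (rule psd_kraus[OF M, where K = "{..<d * D}" and w = w and n = "k * D"])
    show "ext_map k d D (apply_choi d D J) M \<in> carrier_mat (k * D) (k * D)" by (simp add: ext_map_def)
    fix x y assume xy: "x < k * D" "y < k * D"
    define s t r c where "s = x div D" and "t = y div D" and "r = x mod D" and "c = y mod D"
    have st: "s < k" "t < k" "r < D" "c < D"
      using xy D by (simp_all add: s_def t_def r_def c_def less_mult_imp_div_less)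
    have "(\<Sum>a<k * d. \<Sum>b<k * d. cnj (w l x a) * M $$ (a, b) * w l y b) =
        (\<Sum>i<d. \<Sum>i'<d. C $$ (i * D + r, l) * M $$ (s * d + i, t * d + i') * cnj (C $$ (i' * D + c, l)))" for l
    proof -
      have inner: "(\<Sum>b<k * d. z b * w l y b) = (\<Sum>i'<d. z (t * d + i') * cnj (C $$ (i' * D + c, l)))" for z
      proof -
        have "(\<Sum>b<k * d. z b * w l y b) = (\<Sum>t'<k. \<Sum>i'<d. z (t' * d + i') * w l y (t' * d + i'))"
          by (rule sum_lessThan_mult)
        also have "\<dots> = (\<Sum>t'<k. if t' = t then \<Sum>i'<d. z (t * d + i') * cnj (C $$ (i' * D + c, l)) else 0)"
          by (intro sum.cong refl) (auto simp: w_def t_def c_def intro!: sum.cong)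
        finally show ?thesis using st by simp
      qed
      have outer: "(\<Sum>a<k * d. cnj (w l x a) * z a) = (\<Sum>i<d. C $$ (i * D + r, l) * z (s * d + i))" for z
      proof -
        have "(\<Sum>a<k * d. cnj (w l x a) * z a) = (\<Sum>s'<k. \<Sum>i<d. cnj (w l x (s' * d + i)) * z (s' * d + i))"
          by (rule sum_lessThan_mult)
        also have "\<dots> = (\<Sum>s'<k. if s' = s then \<Sum>i<d. C $$ (i * D + r, l) * z (s * d + i) else 0)"
          by (intro sum.cong refl) (auto simp: w_def s_def r_def intro!: sum.cong)
        finally show ?thesis using st by simp
      qed
      have "(\<Sum>a<k * d. \<Sum>b<k * d. cnj (w l x a) * M $$ (a, b) * w l y b) =
          (\<Sum>a<k * d. cnj (w l x a) * (\<Sum>b<k * d. M $$ (a, b) * w l y b))"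
        by (simp add: sum_distrib_left mult.assoc)
      also have "\<dots> = (\<Sum>i<d. C $$ (i * D + r, l) * (\<Sum>i'<d. M $$ (s * d + i, t * d + i') * cnj (C $$ (i' * D + c, l))))"
        unfolding inner outer ..
      finally show ?thesis by (simp add: sum_distrib_left mult.assoc)
    qed
    then have "(\<Sum>l<d * D. \<Sum>a<k * d. \<Sum>b<k * d. cnj (w l x a) * M $$ (a, b) * w l y b) =
        (\<Sum>l<d * D. \<Sum>i<d. \<Sum>i'<d. C $$ (i * D + r, l) * M $$ (s * d + i, t * d + i') * cnj (C $$ (i' * D + c, l)))"
      by simp
    also have "\<dots> = (\<Sum>i<d. \<Sum>l<d * D. \<Sum>i'<d. C $$ (i * D + r, l) * M $$ (s * d + i, t * d + i') * cnj (C $$ (i' * D + c, l)))"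
      by (rule sum.swap)
    also have "\<dots> = (\<Sum>i<d. \<Sum>i'<d. \<Sum>l<d * D. C $$ (i * D + r, l) * M $$ (s * d + i, t * d + i') * cnj (C $$ (i' * D + c, l)))"
      by (rule sum.cong[OF refl], rule sum.swap)
    also have "\<dots> = (\<Sum>i<d. \<Sum>i'<d. M $$ (s * d + i, t * d + i') * J $$ (i * D + r, i' * D + c))"
    proof (intro sum.cong refl)
      fix i i' assume "i \<in> {..<d}" "i' \<in> {..<d}"
      then have "J $$ (i * D + r, i' * D + c) = (\<Sum>l<d * D. C $$ (i * D + r, l) * cnj (C $$ (i' * D + c, l)))"
        using st by (intro J_index index_less_mult) auto
      then show "(\<Sum>l<d * D. C $$ (i * D + r, l) * M $$ (s * d + i, t * d + i') * cnj (C $$ (i' * D + c, l))) =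
          M $$ (s * d + i, t * d + i') * J $$ (i * D + r, i' * D + c)"
        by (simp only: sum_distrib_left) (simp only: mult_ac)
    qed
    also have "\<dots> = ext_map k d D (apply_choi d D J) M $$ (x, y)"
      using xy st by (simp add: ext_map_def apply_choi_def block_def flip: s_def t_def r_def c_def)
    finally show "ext_map k d D (apply_choi d D J) M $$ (x, y) =
        (\<Sum>l<d * D. \<Sum>a<k * d. \<Sum>b<k * d. cnj (w l x a) * M $$ (a, b) * w l y b)" ..
  qed
qed

lemma apply_choi_quantum_channel:
  assumes d: "0 < d" and J: "J \<in> carrier_mat (d ^ (n + 1)) (d ^ (n + 1))" "psd J" and tr: "ptr_keep d (n + 1) 0 J = 1\<^sub>m d"
  shows "quantum_channel d (d ^ n) (apply_choi d (d ^ n) J)"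
  unfolding quantum_channel_def
proof (intro conjI ballI allI impI)
  let ?D = "d ^ n"
  fix A :: "complex mat" assume A: "A \<in> carrier_mat d d"
  show "apply_choi d ?D J A \<in> carrier_mat ?D ?D" by (rule apply_choi_carrier)
  show "apply_choi d ?D J (c \<cdot>\<^sub>m A) = c \<cdot>\<^sub>m apply_choi d ?D J A" for c
    using A by (intro eq_matI) (auto simp: apply_choi_def sum_distrib_left mult.assoc)
  show "apply_choi d ?D J (A + B) = apply_choi d ?D J A + apply_choi d ?D J B" if "B \<in> carrier_mat d d" for B
    using A that by (intro eq_matI) (auto simp: apply_choi_def sum.distrib distrib_right)
  show "mtrace (apply_choi d ?D J A) = mtrace A"
  proof -
    have "mtrace (apply_choi d ?D J A) = (\<Sum>r<?D. \<Sum>i<d. \<Sum>k<d. A $$ (i, k) * J $$ (i * ?D + r, k * ?D + r))"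
      by (simp add: mtrace_def apply_choi_def)
    also have "\<dots> = (\<Sum>i<d. \<Sum>r<?D. \<Sum>k<d. A $$ (i, k) * J $$ (i * ?D + r, k * ?D + r))"
      by (rule sum.swap)
    also have "\<dots> = (\<Sum>i<d. \<Sum>k<d. \<Sum>r<?D. A $$ (i, k) * J $$ (i * ?D + r, k * ?D + r))"
      by (rule sum.cong[OF refl], rule sum.swap)
    \<comment> \<open>The trace of block (i, k) is an entry of the input marginal, so the marginal
      being the identity is exactly trace preservation.\<close>
    also have "\<dots> = (\<Sum>i<d. \<Sum>k<d. A $$ (i, k) * ptr_keep d (n + 1) 0 J $$ (i, k))"
      by (intro sum.cong refl) (simp add: ptr_keep_input[OF d, simplified] sum_distrib_left)
    also have "\<dots> = (\<Sum>i<d. \<Sum>k<d. if k = i then A $$ (i, k) else 0)"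
      unfolding tr by (intro sum.cong refl) auto
    finally show ?thesis using A by (simp add: mtrace_carrier)
  qed
next
  fix k M assume "M \<in> carrier_mat (k * d) (k * d)" "psd M"
  then show "psd (ext_map k d (d ^ n) (apply_choi d (d ^ n) J) M)"
    using d J by (intro psd_ext_map_apply_choi) auto
qed

section \<open>The Choi matrix of a channel\<close>

definition unit_mat :: "nat \<Rightarrow> nat \<Rightarrow> nat \<Rightarrow> complex mat" where
  "unit_mat d i k = mat d d (\<lambda>(a, b). if a = i \<and> b = k then 1 else 0)"

text \<open>The sum of E_ik \<otimes> \<Lambda>(E_ik) with the input first. It is left unnormalised,
  so that a channel has the identity as input marginal.\<close>

definition choi :: "nat \<Rightarrow> nat \<Rightarrow> (complex mat \<Rightarrow> complex mat) \<Rightarrow> complex mat" where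
  "choi d D \<Lambda> = mat (d * D) (d * D) (\<lambda>(x, y). \<Lambda> (unit_mat d (x div D) (y div D)) $$ (x mod D, y mod D))"

lemma unit_mat_carrier: "unit_mat d i k \<in> carrier_mat d d"
  by (simp add: unit_mat_def)

lemma choi_carrier: "choi d D \<Lambda> \<in> carrier_mat (d * D) (d * D)"
  by (simp add: choi_def)

lemma choi_index:
  assumes "i < d" "k < d" "r < D" "c < D"
  shows "choi d D \<Lambda> $$ (i * D + r, k * D + c) = \<Lambda> (unit_mat d i k) $$ (r, c)"
  using assms index_less_mult[of i d r D] index_less_mult[of k d c D] by (simp add: choi_def)

text \<open>The Choi matrix is the image of the unnormalised maximally entangled state \<Omega>
  under id \<otimes> \<Lambda>, so complete positivity with an ancilla of dimension \<open>d\<close>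
  applies.\<close>

lemma choi_psd:
  assumes d: "0 < d" and D: "0 < D" and \<Lambda>: "quantum_channel d D \<Lambda>"
  shows "psd (choi d D \<Lambda>)"
proof -
  define v where "v = mat (d * d) 1 (\<lambda>(x, _). if x div d = x mod d then 1 else 0 :: complex)"
  have v: "v \<in> carrier_mat (d * d) 1" by (simp add: v_def)
  define \<Omega> where "\<Omega> = v * mat_adjoint v"
  have \<Omega>: "\<Omega> \<in> carrier_mat (d * d) (d * d)" "psd \<Omega>" using v by (auto simp: \<Omega>_def psd_gram)
  have \<Omega>_index: "\<Omega> $$ (x, y) = (if x div d = x mod d \<and> y div d = y mod d then 1 else 0)" if "x < d * d" "y < d * d" for x y
  proof -
    have "\<Omega> $$ (x, y) = (\<Sum>l<1. v $$ (x, l) * mat_adjoint v $$ (l, y))"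
      unfolding \<Omega>_def using v that by (intro mult_index) auto
    then show ?thesis using that by (simp add: v_def)
  qed
  have "ext_map d d D \<Lambda> \<Omega> = choi d D \<Lambda>"
  proof (rule eq_matI)
    fix x y assume "x < dim_row (choi d D \<Lambda>)" "y < dim_col (choi d D \<Lambda>)"
    then have xy: "x < d * D" "y < d * D" by (simp_all add: choi_def)
    then have xd: "x div D < d" "y div D < d" by (simp_all add: less_mult_imp_div_less)
    have "block d \<Omega> (x div D) (y div D) = unit_mat d (x div D) (y div D)"
      by (rule eq_matI) (use xd in \<open>auto simp: block_def unit_mat_def \<Omega>_index index_less_mult\<close>)
    then show "ext_map d d D \<Lambda> \<Omega> $$ (x, y) = choi d D \<Lambda> $$ (x, y)"
      using xy by (simp add: ext_map_def choi_def)
  qed (simp_all add: ext_map_def choi_def)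
  then show ?thesis using \<Lambda> \<Omega> unfolding quantum_channel_def by metis
qed

lemma channel_expand:
  assumes \<Lambda>: "quantum_channel d D \<Lambda>" and A: "A \<in> carrier_mat d d" and rc: "r < D" "c < D"
  shows "\<Lambda> A $$ (r, c) = (\<Sum>i<d. \<Sum>k<d. A $$ (i, k) * \<Lambda> (unit_mat d i k) $$ (r, c))"
proof -
  have car: "\<Lambda> B \<in> carrier_mat D D" if "B \<in> carrier_mat d d" for B
    using \<Lambda> that by (simp add: quantum_channel_def)
  have add: "\<Lambda> (B + B') = \<Lambda> B + \<Lambda> B'" if "B \<in> carrier_mat d d" "B' \<in> carrier_mat d d" for B B'
    using \<Lambda> that by (simp add: quantum_channel_def)
  have smult: "\<Lambda> (a \<cdot>\<^sub>m B) = a \<cdot>\<^sub>m \<Lambda> B" if "B \<in> carrier_mat d d" for a B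
    using \<Lambda> that by (simp add: quantum_channel_def)
  \<comment> \<open>\<open>P S\<close> keeps the entries of \<open>A\<close> at positions in
    \<open>S\<close> and puts zero elsewhere; linearity is extended to finite sums by induction on
    \<open>S\<close>.\<close>
  define P where "P S = mat d d (\<lambda>x. if x \<in> S then A $$ x else 0)" for S
  have P: "P S \<in> carrier_mat d d" for S by (simp add: P_def)
  have main: "\<Lambda> (P S) $$ (r, c) = (\<Sum>(i, k)\<in>S. A $$ (i, k) * \<Lambda> (unit_mat d i k) $$ (r, c))"
    if "finite S" for S using that
  proof (induction S rule: finite_induct)
    case empty
    \<comment> \<open>Writing the zero matrix as zero times itself lets homogeneity give the value
      at it.\<close>
    have "P {} = 0 \<cdot>\<^sub>m P {}" by (rule eq_matI) (auto simp: P_def)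
    then have "\<Lambda> (P {}) = 0 \<cdot>\<^sub>m \<Lambda> (P {})" using smult[OF P] by metis
    then have "\<Lambda> (P {}) $$ (r, c) = (0 \<cdot>\<^sub>m \<Lambda> (P {})) $$ (r, c)" by simp
    then show ?case using rc car[OF P[of "{}"]] by simp
  next
    case (insert x S)
    obtain i k where x: "x = (i, k)" by (cases x)
    have "P (insert x S) = A $$ (i, k) \<cdot>\<^sub>m unit_mat d i k + P S"
      by (rule eq_matI) (use insert(2) in \<open>auto simp: P_def unit_mat_def x\<close>)
    then have "\<Lambda> (P (insert x S)) = A $$ (i, k) \<cdot>\<^sub>m \<Lambda> (unit_mat d i k) + \<Lambda> (P S)"
      by (simp add: add smult P unit_mat_carrier)
    then show ?case
      using insert rc car[OF P[of S]] car[OF unit_mat_carrier[of d i k]] by (simp add: x)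
  qed
  have "P ({..<d} \<times> {..<d}) = A" by (rule eq_matI) (use A in \<open>auto simp: P_def\<close>)
  then show ?thesis using main[of "{..<d} \<times> {..<d}"] by (simp add: sum.cartesian_product)
qed

lemma apply_choi_choi:
  assumes \<Lambda>: "quantum_channel d D \<Lambda>" and A: "A \<in> carrier_mat d d"
  shows "apply_choi d D (choi d D \<Lambda>) A = \<Lambda> A"
proof (rule eq_matI)
  have car: "\<Lambda> A \<in> carrier_mat D D" using \<Lambda> A by (simp add: quantum_channel_def)
  then show "dim_row (apply_choi d D (choi d D \<Lambda>) A) = dim_row (\<Lambda> A)" "dim_col (apply_choi d D (choi d D \<Lambda>) A) = dim_col (\<Lambda> A)"
    by (simp_all add: apply_choi_def)
  fix r c assume "r < dim_row (\<Lambda> A)" "c < dim_col (\<Lambda> A)"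
  then have rc: "r < D" "c < D" using car by simp_all
  then show "apply_choi d D (choi d D \<Lambda>) A $$ (r, c) = \<Lambda> A $$ (r, c)"
    unfolding channel_expand[OF \<Lambda> A rc] by (simp add: apply_choi_def choi_index)
qed

lemma choi_ptr_input:
  assumes d: "0 < d" and \<Lambda>: "quantum_channel d (d ^ n) \<Lambda>"
  shows "ptr_keep d (n + 1) 0 (choi d (d ^ n) \<Lambda>) = 1\<^sub>m d"
proof (rule eq_matI)
  fix a b assume "a < dim_row (1\<^sub>m d :: complex mat)" "b < dim_col (1\<^sub>m d :: complex mat)"
  then have ab: "a < d" "b < d" by simp_all
  have car: "\<Lambda> (unit_mat d a b) \<in> carrier_mat (d ^ n) (d ^ n)"
    using \<Lambda> unit_mat_carrier by (simp add: quantum_channel_def)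
  have "ptr_keep d (n + 1) 0 (choi d (d ^ n) \<Lambda>) $$ (a, b) = mtrace (\<Lambda> (unit_mat d a b))"
    unfolding ptr_keep_input[OF d ab] mtrace_carrier[OF car] by (intro sum.cong refl) (simp add: choi_index ab)
  also have "\<dots> = mtrace (unit_mat d a b)"
    using \<Lambda> unit_mat_carrier by (simp add: quantum_channel_def)
  also have "\<dots> = (\<Sum>i<d. if i = a then if a = b then 1 else 0 else 0)"
    unfolding mtrace_carrier[OF unit_mat_carrier] by (intro sum.cong refl) (auto simp: unit_mat_def)
  finally show "ptr_keep d (n + 1) 0 (choi d (d ^ n) \<Lambda>) $$ (a, b) = 1\<^sub>m d $$ (a, b)"
    using ab by simp
qed (simp_all add: ptr_keep_def)

text \<open>Complete positivity with a one-dimensional ancilla.\<close>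

lemma channel_psd:
  assumes \<Lambda>: "quantum_channel d D \<Lambda>" and A: "A \<in> carrier_mat d d" "psd A"
  shows "psd (\<Lambda> A)"
proof -
  have "block d A 0 0 = A" using A(1) by (intro eq_matI) (auto simp: block_def)
  then have "ext_map 1 d D \<Lambda> A = \<Lambda> A"
    using \<Lambda> A(1) by (intro eq_matI) (auto simp: ext_map_def quantum_channel_def)
  moreover have "psd (ext_map 1 d D \<Lambda> A)" using \<Lambda> A unfolding quantum_channel_def by simp
  ultimately show ?thesis by simp
qed

text \<open>Convexity of the positive cone, stated entrywise so that block matrices can be averaged
  block by block.\<close>

lemma psd_average:
  assumes "A \<in> carrier_mat m m" "0 < n" and B: "\<And>j. j < n \<Longrightarrow> B j \<in> carrier_mat m m" "\<And>j. j < n \<Longrightarrow> psd (B j)"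
    and eq: "\<And>x y. x < m \<Longrightarrow> y < m \<Longrightarrow> A $$ (x, y) = (1 / of_nat n) * (\<Sum>j<n. B j $$ (x, y))"
  shows "psd A"
  unfolding psd_iff[OF assms(1)]
proof (intro conjI allI impI)
  have herm: "cnj (B j $$ (y, x)) = B j $$ (x, y)" if "j < n" "x < m" "y < m" for j x y
    using B(2)[OF that(1), unfolded psd_iff[OF B(1)[OF that(1)]], THEN conjunct1] that by blast
  then show "cnj (A $$ (y, x)) = A $$ (x, y)" if "x < m" "y < m" for x y
    using that by (simp add: eq)
  fix f :: "nat \<Rightarrow> complex"
  have "(\<Sum>x<m. \<Sum>y<m. cnj (f x) * A $$ (x, y) * f y) =
      (\<Sum>x<m. \<Sum>y<m. \<Sum>j<n. (1 / of_nat n) * (cnj (f x) * B j $$ (x, y) * f y))"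
    by (intro sum.cong refl) (simp add: eq sum_distrib_left sum_distrib_right mult_ac)
  also have "\<dots> = (\<Sum>x<m. \<Sum>j<n. \<Sum>y<m. (1 / of_nat n) * (cnj (f x) * B j $$ (x, y) * f y))"
    by (rule sum.cong[OF refl], rule sum.swap)
  also have "\<dots> = (\<Sum>j<n. \<Sum>x<m. \<Sum>y<m. (1 / of_nat n) * (cnj (f x) * B j $$ (x, y) * f y))"
    by (rule sum.swap)
  also have "\<dots> = (\<Sum>j<n. (1 / of_nat n) * (\<Sum>x<m. \<Sum>y<m. cnj (f x) * B j $$ (x, y) * f y))"
    by (simp only: sum_distrib_left)
  also have "0 \<le> \<dots>"
  proof (rule sum_nonneg, rule mult_nonneg_nonneg)
    fix j assume "j \<in> {..<n}"
    then have j: "j < n" by simp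
    show "0 \<le> 1 / (of_nat n :: complex)" by (simp add: less_eq_complex_def)
    show "0 \<le> (\<Sum>x<m. \<Sum>y<m. cnj (f x) * B j $$ (x, y) * f y)"
      by (rule B(2)[OF j, unfolded psd_iff[OF B(1)[OF j]], THEN conjunct2, THEN spec])
  qed
  finally show "0 \<le> (\<Sum>x<m. \<Sum>y<m. cnj (f x) * A $$ (x, y) * f y)" .
qed

lemma Re_mtrace_symmetrized:
  "X \<in> carrier_mat d d \<Longrightarrow> Re (mtrace (X + mat_adjoint X)) = 2 * Re (mtrace X)"
  by (simp add: mtrace_add[of _ d] mtrace_adj[of _ d])

section \<open>Equality of the two optimization problems\<close>

text \<open>The value is matched exactly and not only bounded, since tr is linear and each block
  \<open>Y i j\<close> attains its fidelity. The constraint mentions system 1 alone, but after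
  twirling its marginal carries the mean over all outputs.\<close>

lemma sdp_value_of_channel:
  assumes d: "0 < d" and n: "1 \<le> n" and \<rho>: "\<And>i. i < m \<Longrightarrow> density d (\<rho> i)" and \<Lambda>: "quantum_channel d (d ^ n) \<Lambda>"
  obtains X J where "sdp_feasible d n m \<rho> X J"
    "(\<Sum>i<m. (1 / 2) * p i * Re (mtrace (X i + mat_adjoint (X i)))) =
      (\<Sum>i<m. \<Sum>j<n. (1 / real n) * p i * fidelity (\<rho> i) (ptr_keep d n j (\<Lambda> (\<rho> i))))"
proof -
  define J0 where "J0 = choi d (d ^ n) \<Lambda>"
  define J where "J = sym_twirl d n J0"
  define \<sigma> where "\<sigma> i j = ptr_keep d n j (\<Lambda> (\<rho> i))" for i j
  have J0: "J0 \<in> carrier_mat (d ^ (n + 1)) (d ^ (n + 1))" "psd J0" "ptr_keep d (n + 1) 0 J0 = 1\<^sub>m d"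
    using choi_carrier[of d "d ^ n" \<Lambda>] choi_psd[OF d _ \<Lambda>] choi_ptr_input[OF d \<Lambda>] d by (simp_all add: J0_def)
  have \<rho>c: "\<rho> i \<in> carrier_mat d d" "psd (\<rho> i)" if "i < m" for i
    using \<rho>[OF that] by (simp_all add: density_def)
  have \<sigma>c: "\<sigma> i j \<in> carrier_mat d d" "psd (\<sigma> i j)" if "i < m" for i j
    using \<Lambda> \<rho>c[OF that] channel_psd[OF \<Lambda>] unfolding \<sigma>_def
    by (auto intro!: ptr_keep_carrier ptr_keep_psd simp: quantum_channel_def)
  have "\<exists>Y. Y \<in> carrier_mat d d \<and> psd (four_block_mat (\<rho> i) Y (mat_adjoint Y) (\<sigma> i j)) \<and>
      Re (mtrace Y) = fidelity (\<rho> i) (\<sigma> i j)" if "i < m" for i j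
    using fidelity_attained[OF \<rho>c[OF that] \<sigma>c[OF that]] by metis
  then obtain Y where Y: "\<And>i j. i < m \<Longrightarrow> Y i j \<in> carrier_mat d d"
    "\<And>i j. i < m \<Longrightarrow> psd (four_block_mat (\<rho> i) (Y i j) (mat_adjoint (Y i j)) (\<sigma> i j))"
    "\<And>i j. i < m \<Longrightarrow> Re (mtrace (Y i j)) = fidelity (\<rho> i) (\<sigma> i j)" by metis
  define X where "X i = mat d d (\<lambda>x. (1 / of_nat n) * (\<Sum>j<n. Y i j $$ x))" for i
  have X: "X i \<in> carrier_mat d d" for i by (simp add: X_def)
  define T where "T i = ptr_keep d (n + 1) 1 (J * kron (transpose_mat (\<rho> i)) (1\<^sub>m (d ^ n)))" for i
  have T_index: "T i $$ (a, b) = (1 / of_nat n) * (\<Sum>j<n. \<sigma> i j $$ (a, b))" if i: "i < m" and ab: "a < d" "b < d" for i a b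
  proof -
    let ?L = "J0 * kron (transpose_mat (\<rho> i)) (1\<^sub>m (d ^ n))"
    have L: "?L \<in> carrier_mat (d ^ (n + 1)) (d ^ (n + 1))"
      using J0(1) kron_one_carrier[OF \<rho>c(1)[OF i]] by (rule mult_carrier_mat)
    have "T i = ptr_keep d (n + 1) 1 (sym_twirl d n ?L)"
      unfolding T_def J_def input_sym_twirl[OF d \<rho>c(1)[OF i] J0(1)] ..
    then have "T i $$ (a, b) = (1 / of_nat n) * (\<Sum>j\<in>{1..n}. ptr_keep d (n + 1) j ?L $$ (a, b))"
      using ptr_keep_output_sym_twirl[OF d L _ ab, of 1] n by simp
    \<comment> \<open>Output \<open>j\<close> of the channel is system \<open>Suc j\<close> of the
      Choi matrix, hence the shift.\<close>
    also have "(\<Sum>j\<in>{1..n}. ptr_keep d (n + 1) j ?L $$ (a, b)) = (\<Sum>j<n. ptr_keep d (n + 1) (Suc j) ?L $$ (a, b))"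
      by (rule sum.reindex_bij_witness[where i = Suc and j = "\<lambda>j. j - 1"]) auto
    also have "\<dots> = (\<Sum>j<n. \<sigma> i j $$ (a, b))"
    proof (rule sum.cong[OF refl])
      fix j assume "j \<in> {..<n}"
      then have j: "j < n" by simp
      show "ptr_keep d (n + 1) (Suc j) ?L $$ (a, b) = \<sigma> i j $$ (a, b)"
        unfolding ptr_keep_output[OF d \<rho>c(1)[OF i] J0(1) j] unfolding J0_def apply_choi_choi[OF \<Lambda> \<rho>c(1)[OF i]] \<sigma>_def ..
    qed
    finally show ?thesis .
  qed
  have "sdp_feasible d n m \<rho> X J"
    unfolding sdp_feasible_def
  proof (intro conjI allI impI)
    fix i assume i: "i < m"
    show "X i \<in> carrier_mat d d" by (rule X)
    have Tc: "T i \<in> carrier_mat d d" unfolding T_def by (rule ptr_keep_carrier)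
    have "psd (four_block_mat (\<rho> i) (X i) (mat_adjoint (X i)) (T i))"
    proof (rule psd_average[where B = "\<lambda>j. four_block_mat (\<rho> i) (Y i j) (mat_adjoint (Y i j)) (\<sigma> i j)" and m = "d + d" and n = n])
      show "four_block_mat (\<rho> i) (X i) (mat_adjoint (X i)) (T i) \<in> carrier_mat (d + d) (d + d)"
        using \<rho>c(1)[OF i] Tc by simp
      show "0 < n" using n by simp
      show "four_block_mat (\<rho> i) (Y i j) (mat_adjoint (Y i j)) (\<sigma> i j) \<in> carrier_mat (d + d) (d + d)" for j
        using \<rho>c(1)[OF i] \<sigma>c(1)[OF i] by simp
      show "psd (four_block_mat (\<rho> i) (Y i j) (mat_adjoint (Y i j)) (\<sigma> i j))" for j
        by (rule Y(2)[OF i])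
      fix x y assume xy: "x < d + d" "y < d + d"
      have dims: "dim_row (\<rho> i) = d" "dim_col (\<rho> i) = d" "dim_row (T i) = d" "dim_col (T i) = d"
        "dim_row (X i) = d" "dim_col (X i) = d"
        "\<And>j. dim_row (Y i j) = d" "\<And>j. dim_col (Y i j) = d" "\<And>j. dim_row (\<sigma> i j) = d" "\<And>j. dim_col (\<sigma> i j) = d"
        using \<rho>c(1)[OF i] Tc X[of i] Y(1)[OF i] \<sigma>c(1)[OF i] by auto
      \<comment> \<open>The upper left block is the same for every \<open>j\<close>, so it is its
        own mean, given n > 0.\<close>
      have "(\<rho> i) $$ (x, y) = (1 / of_nat n) * (\<Sum>j<n. (\<rho> i) $$ (x, y))"
        using n by simp
      moreover have "T i $$ (x - d, y - d) = (1 / of_nat n) * (\<Sum>j<n. \<sigma> i j $$ (x - d, y - d))" if "\<not> x < d" "\<not> y < d"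
        using that xy by (intro T_index[OF i]) auto
      ultimately show "four_block_mat (\<rho> i) (X i) (mat_adjoint (X i)) (T i) $$ (x, y) =
          (1 / of_nat n) * (\<Sum>j<n. four_block_mat (\<rho> i) (Y i j) (mat_adjoint (Y i j)) (\<sigma> i j) $$ (x, y))"
        using xy by (cases "x < d"; cases "y < d") (simp_all add: dims X_def)
    qed
    then show "psd (four_block_mat (\<rho> i) (X i) (mat_adjoint (X i))
        (ptr_keep d (n + 1) 1 (J * kron (transpose_mat (\<rho> i)) (1\<^sub>m (d ^ n)))))"
      unfolding T_def .
  next
    show "J \<in> carrier_mat (d ^ (n + 1)) (d ^ (n + 1))" unfolding J_def by (rule sym_twirl_carrier)
    show "psd J" unfolding J_def by (rule sym_twirl_psd[OF d J0(1,2)])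
    then show "hermitian J" by (simp add: psd_def)
    show "ptr_keep d (n + 1) 0 J = 1\<^sub>m d"
      unfolding J_def ptr_keep_input_sym_twirl[OF d J0(1)] by (rule J0(3))
    show "J = sym_twirl d n J" unfolding J_def sym_twirl_idem[OF d J0(1)] ..
  qed
  moreover have "(1 / 2) * p i * Re (mtrace (X i + mat_adjoint (X i))) =
      (\<Sum>j<n. (1 / real n) * p i * fidelity (\<rho> i) (\<sigma> i j))" if i: "i < m" for i
  proof -
    have "mtrace (X i) = (1 / of_nat n) * (\<Sum>j<n. mtrace (Y i j))"
    proof -
      have "mtrace (X i) = (1 / of_nat n) * (\<Sum>a<d. \<Sum>j<n. Y i j $$ (a, a))"
        by (simp add: mtrace_def X_def sum_divide_distrib)
      also have "(\<Sum>a<d. \<Sum>j<n. Y i j $$ (a, a)) = (\<Sum>j<n. mtrace (Y i j))"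
        by (subst sum.swap) (simp add: mtrace_carrier[OF Y(1)[OF i]])
      finally show ?thesis .
    qed
    also have "\<dots> = complex_of_real (1 / real n) * (\<Sum>j<n. mtrace (Y i j))" by simp
    finally have "Re (mtrace (X i)) = (1 / real n) * (\<Sum>j<n. Re (mtrace (Y i j)))"
      by (simp only: Re_complex_of_real Re_sum times_complex.sel Im_complex_of_real)
    then show ?thesis
      by (simp add: Re_mtrace_symmetrized[OF X] Y(3)[OF i] sum_distrib_left sum_divide_distrib mult_ac)
  qed
  ultimately show thesis
    using that[of X J] unfolding \<sigma>_def by simp
qed

text \<open>Invariance of \<open>J\<close> passes to J (\<rho>^T \<otimes> 1), so each output
  marginal equals the one in the constraint. The mean over \<open>j\<close> is then a single
  fidelity, which bounds Re tr X.\<close>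

lemma channel_of_sdp_feasible:
  assumes d: "0 < d" and n: "1 \<le> n" and p: "\<And>i. i < m \<Longrightarrow> 0 \<le> p i"
    and \<rho>: "\<And>i. i < m \<Longrightarrow> density d (\<rho> i)" and feas: "sdp_feasible d n m \<rho> X J"
  obtains \<Lambda> where "quantum_channel d (d ^ n) \<Lambda>"
    "(\<Sum>i<m. (1 / 2) * p i * Re (mtrace (X i + mat_adjoint (X i)))) \<le>
      (\<Sum>i<m. \<Sum>j<n. (1 / real n) * p i * fidelity (\<rho> i) (ptr_keep d n j (\<Lambda> (\<rho> i))))"
proof -
  have J: "J \<in> carrier_mat (d ^ (n + 1)) (d ^ (n + 1))" "psd J" "ptr_keep d (n + 1) 0 J = 1\<^sub>m d" "J = sym_twirl d n J"
    using feas by (auto simp: sdp_feasible_def)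
  define \<Lambda> where "\<Lambda> = apply_choi d (d ^ n) J"
  have \<Lambda>: "quantum_channel d (d ^ n) \<Lambda>"
    unfolding \<Lambda>_def by (rule apply_choi_quantum_channel[OF d J(1,2,3)])
  have "(1 / 2) * p i * Re (mtrace (X i + mat_adjoint (X i))) \<le>
      (\<Sum>j<n. (1 / real n) * p i * fidelity (\<rho> i) (ptr_keep d n j (\<Lambda> (\<rho> i))))" if i: "i < m" for i
  proof -
    have \<rho>c: "\<rho> i \<in> carrier_mat d d" "psd (\<rho> i)" using \<rho>[OF i] by (simp_all add: density_def)
    let ?L = "J * kron (transpose_mat (\<rho> i)) (1\<^sub>m (d ^ n))"
    define \<sigma> where "\<sigma> = ptr_keep d (n + 1) 1 ?L"
    have L: "?L \<in> carrier_mat (d ^ (n + 1)) (d ^ (n + 1))"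
      using J(1) kron_one_carrier[OF \<rho>c(1)] by (rule mult_carrier_mat)
    have Lt: "?L = sym_twirl d n ?L"
      using input_sym_twirl[OF d \<rho>c(1) J(1)] J(4) by simp
    have marg: "ptr_keep d n j (\<Lambda> (\<rho> i)) = \<sigma>" if j: "j < n" for j
    proof -
      have "ptr_keep d n j (\<Lambda> (\<rho> i)) = ptr_keep d (n + 1) (Suc j) (sym_twirl d n ?L)"
        unfolding \<Lambda>_def ptr_keep_output[OF d \<rho>c(1) J(1) j, symmetric] using Lt by simp
      also have "\<dots> = ptr_keep d (n + 1) 1 (sym_twirl d n ?L)"
      \<comment> \<open>Either side is the mean of the marginals of \<open>?L\<close>, whichever
        output is kept.\<close>
      proof (rule eq_matI)
        fix a b assume "a < dim_row (ptr_keep d (n + 1) 1 (sym_twirl d n ?L))" "b < dim_col (ptr_keep d (n + 1) 1 (sym_twirl d n ?L))"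
        then have ab: "a < d" "b < d" by (simp_all add: ptr_keep_def)
        have "Suc j \<in> {1..n}" "1 \<in> {1..n}" using j n by auto
        then show "ptr_keep d (n + 1) (Suc j) (sym_twirl d n ?L) $$ (a, b) = ptr_keep d (n + 1) 1 (sym_twirl d n ?L) $$ (a, b)"
          by (simp only: ptr_keep_output_sym_twirl[OF d L _ ab])
      qed (simp_all add: ptr_keep_def)
      also have "\<dots> = \<sigma>" unfolding \<sigma>_def using Lt by simp
      finally show ?thesis .
    qed
    have \<Lambda>\<rho>: "\<Lambda> (\<rho> i) \<in> carrier_mat (d ^ n) (d ^ n)" unfolding \<Lambda>_def by (rule apply_choi_carrier)
    \<comment> \<open>\<open>?L\<close> need not be Hermitian, so positivity of \<sigma> is read off
      from the channel output instead; output 0 exists because n \<ge> 1.\<close>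
    have \<sigma>: "\<sigma> \<in> carrier_mat d d" "psd \<sigma>"
      using marg[of 0] n ptr_keep_psd[OF \<Lambda>\<rho> channel_psd[OF \<Lambda> \<rho>c], of 0] unfolding \<sigma>_def
      by (auto simp: ptr_keep_carrier)
    have X: "X i \<in> carrier_mat d d" "psd (four_block_mat (\<rho> i) (X i) (mat_adjoint (X i)) \<sigma>)"
      using feas i unfolding sdp_feasible_def \<sigma>_def by auto
    have "(1 / 2) * p i * Re (mtrace (X i + mat_adjoint (X i))) = p i * Re (mtrace (X i))"
      by (simp add: Re_mtrace_symmetrized[OF X(1)])
    also have "\<dots> \<le> p i * fidelity (\<rho> i) \<sigma>"
      using fidelity_upper[OF \<rho>c \<sigma> X] p[OF i] by (rule mult_left_mono)
    also have "\<dots> = (\<Sum>j<n. (1 / real n) * p i * fidelity (\<rho> i) \<sigma>)"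
      using n by simp
    also have "\<dots> = (\<Sum>j<n. (1 / real n) * p i * fidelity (\<rho> i) (ptr_keep d n j (\<Lambda> (\<rho> i))))"
      by (intro sum.cong refl) (simp add: marg)
    finally show ?thesis .
  qed
  then show thesis
    using that[OF \<Lambda>] by (meson sum_mono lessThan_iff)
qed

text \<open>For an unbounded set \<open>Sup\<close> is a junk value, but it depends only on the set of upper bounds.\<close>
lemma Sup_eq_if_dominating:
  fixes S T :: "real set"
  assumes "\<And>x. x \<in> S \<Longrightarrow> \<exists>y\<in>T. x \<le> y" "\<And>y. y \<in> T \<Longrightarrow> \<exists>x\<in>S. y \<le> x"
  shows "Sup S = Sup T"
proof -
  have "(\<forall>x\<in>S. x \<le> z) \<longleftrightarrow> (\<forall>y\<in>T. y \<le> z)" for z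
    using assms by (meson order_trans)
  then show ?thesis by (simp add: Sup_real_def)
qed

theorem theorem5:
  fixes d n m :: nat and p :: "nat \<Rightarrow> real" and \<rho> :: "nat \<Rightarrow> complex mat"
  assumes "0 < d" and "1 \<le> n"
    and "\<forall>i<m. 0 \<le> p i" and "(\<Sum>i<m. p i) = 1"
    and "\<forall>i<m. density d (\<rho> i)"
  shows "broadcast_fidelity d n m p \<rho> = sdp_value d n m p \<rho>"
  unfolding broadcast_fidelity_def sdp_value_def
proof (rule Sup_eq_if_dominating)
  fix x assume "x \<in> (\<lambda>\<Lambda>. \<Sum>i<m. \<Sum>j<n. (1 / real n) * p i * fidelity (\<rho> i) (ptr_keep d n j (\<Lambda> (\<rho> i)))) `
    {\<Lambda>. quantum_channel d (d ^ n) \<Lambda>}"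
  then obtain \<Lambda> where \<Lambda>: "quantum_channel d (d ^ n) \<Lambda>"
    and x: "x = (\<Sum>i<m. \<Sum>j<n. (1 / real n) * p i * fidelity (\<rho> i) (ptr_keep d n j (\<Lambda> (\<rho> i))))" by auto
  obtain X J where "sdp_feasible d n m \<rho> X J" "(\<Sum>i<m. (1 / 2) * p i * Re (mtrace (X i + mat_adjoint (X i)))) = x"
    using sdp_value_of_channel[OF assms(1,2) _ \<Lambda>, of m \<rho> p] assms(5) unfolding x by blast
  then show "\<exists>y\<in>{\<Sum>i<m. (1 / 2) * p i * Re (mtrace (X i + mat_adjoint (X i))) | X J. sdp_feasible d n m \<rho> X J}. x \<le> y"
    by (intro bexI[of _ x]) auto
next
  fix y assume "y \<in> {\<Sum>i<m. (1 / 2) * p i * Re (mtrace (X i + mat_adjoint (X i))) | X J. sdp_feasible d n m \<rho> X J}"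
  then obtain X J where feas: "sdp_feasible d n m \<rho> X J"
    and y: "y = (\<Sum>i<m. (1 / 2) * p i * Re (mtrace (X i + mat_adjoint (X i))))" by blast
  obtain \<Lambda> where "quantum_channel d (d ^ n) \<Lambda>"
    "y \<le> (\<Sum>i<m. \<Sum>j<n. (1 / real n) * p i * fidelity (\<rho> i) (ptr_keep d n j (\<Lambda> (\<rho> i))))"
    using channel_of_sdp_feasible[OF assms(1,2) _ _ feas, of p] assms(3,5) unfolding y by blast
  then show "\<exists>x\<in>(\<lambda>\<Lambda>. \<Sum>i<m. \<Sum>j<n. (1 / real n) * p i * fidelity (\<rho> i) (ptr_keep d n j (\<Lambda> (\<rho> i)))) `
    {\<Lambda>. quantum_channel d (d ^ n) \<Lambda>}. y \<le> x"
    by blast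
qed

end
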